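(* Let $A$ be a commutative unital locally convex algebra and $G$ a compact abelian group. A dynamical system $(A,G,\alpha)$ is free if the map $$\operatorname{ev}^{\varphi}_{\chi}:A_{\varphi}\to\mathbb{C},\qquad a\mapsto\chi(a)$$ is surjective for all $\varphi\in\widehat{G}$ and all $\chi\in\Gamma_A$.
   Context: The ground field is $\mathbb{C}$. A dynamical system $(A,G,\alpha)$ consists of a unital locally convex algebra $A$ (jointly continuous multiplication), a topological group $G$ and a group homomorphism $\alpha:G\to\operatorname{Aut}(A)$ such that $(g,a)\mapsto\alpha(g)(a)$ is continuous on $G\times A$. $\Gamma_A$ is the set of nonzero algebra homomorphisms $A\to\mathbb{C}$. $\widehat{G}$ is the group of continuous homomorphisms $G\to\mathbb{T}$, and for $\varphi\in\widehat{G}$ the isotypic component is $A_{\varphi}:=\{a\in A:(\forall g\in G)\ \alpha(g)(a)=\varphi(g)\cdot a\}$. For a continuous representation $(\pi,V)$ of $G$ (on a locally convex space), $\Gamma_AV:=\{s\in A\otimes V:(\forall g\in G)\ (\alpha(g)\otimes\operatorname{id}_V)(s)=(\operatorname{id}_A\otimes\pi(g^{-1}))(s)\}$. The system $(A,G,\alpha)$ (with $A$ commutative) is called free if there is a family $(\pi_j,V_j)_{j\in J}$ of continuous representations separating the points of $G$ (for each $g\ne 1_G$ some $\pi_j(g)\neq\operatorname{id}_{V_j}$) such that for all $j\in J$ and $\chi\in\Gamma_A$ the map $\Gamma_AV_j\to V_j$, $a\otimes v\mapsto\chi(a)v$ (the restriction of $\chi\otimes\operatorname{id}_{V_j}$)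 is surjective. *)

theory Defs
  imports "HOL-Analysis.Analysis" "HOL-Library.Poly_Mapping"
begin

section \<open>Locally convex spaces and algebras\<close>

text \<open>
  Complex vector spaces are given by a scalar multiplication satisfying the library locale
  \<^locale>\<open>vector_space\<close>. A locally convex space is a topology whose
  underlying set \<^term>\<open>topspace T\<close> is a linear subspace of the ambient type. The Hausdorff
  axiom is not part of this definition; it is required separately where it matters.
\<close>

definition complex_convex :: "(complex \<Rightarrow> 'v::ab_group_add \<Rightarrow> 'v) \<Rightarrow> 'v set \<Rightarrow> bool" where
  "complex_convex smul W \<longleftrightarrow>
     (\<forall>x\<in>W. \<forall>y\<in>W. \<forall>t::real. 0 \<le> t \<and> t \<le> 1 \<longrightarrow>
        smul (complex_of_real (1 - t)) x + smul (complex_of_real t) y \<in> W)"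

definition locally_convex_space ::
    "(complex \<Rightarrow> 'v::ab_group_add \<Rightarrow> 'v) \<Rightarrow> 'v topology \<Rightarrow> bool" where
  "locally_convex_space smul T \<longleftrightarrow>
     vector_space smul \<and>
     module.subspace smul (topspace T) \<and>
     continuous_map (prod_topology T T) T (\<lambda>(x, y). x + y) \<and>
     continuous_map (prod_topology euclidean T) T (\<lambda>(c, x). smul c x) \<and>
     (\<forall>U. openin T U \<and> 0 \<in> U \<longrightarrow>
        (\<exists>W. openin T W \<and> 0 \<in> W \<and> W \<subseteq> U \<and> complex_convex smul W))"

text \<open>
  The sort \<open>{ring, monoid_mult}\<close> is that of unital rings; unlike \<open>ring_1\<close> it
  does not exclude the zero ring.
\<close>

definition locally_convex_algebra ::
    "(complex \<Rightarrow> 'a::{ring, monoid_mult} \<Rightarrow> 'a) \<Rightarrow> 'a topology \<Rightarrow> bool" where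
  "locally_convex_algebra smul T \<longleftrightarrow>
     locally_convex_space smul T \<and>
     topspace T = UNIV \<and>
     (\<forall>c a b. smul c (a * b) = smul c a * b \<and> smul c (a * b) = a * smul c b) \<and>
     continuous_map (prod_topology T T) T (\<lambda>(a, b). a * b)"

definition algebra_automorphism ::
    "(complex \<Rightarrow> 'a::{ring, monoid_mult} \<Rightarrow> 'a) \<Rightarrow> ('a \<Rightarrow> 'a) \<Rightarrow> bool" where
  "algebra_automorphism smul f \<longleftrightarrow>
     Vector_Spaces.linear smul smul f \<and> (\<forall>a b. f (a * b) = f a * f b) \<and> bij f"

definition characters ::
    "(complex \<Rightarrow> 'a::{ring, monoid_mult} \<Rightarrow> 'a) \<Rightarrow> ('a \<Rightarrow> complex) set" where
  "characters smul =
     {\<xi>. Vector_Spaces.linear smul (*) \<xi> \<and> (\<forall>a b. \<xi> (a * b) = \<xi> a * \<xi> b) \<and> (\<exists>a. \<xi> a \<noteq> 0)}"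


section \<open>Dynamical systems\<close>

text \<open>
  The topological group is a type of class \<^class>\<open>topological_group_add\<close>, so its (not
  necessarily commutative) group law is written additively. Each \<open>\<alpha> g\<close> is
  automatically a homeomorphism, because the action map is continuous and
  \<open>\<alpha> (- g)\<close> is the inverse of \<open>\<alpha> g\<close>.
\<close>

definition dynamical_system ::
    "(complex \<Rightarrow> 'a::{ring, monoid_mult} \<Rightarrow> 'a) \<Rightarrow> 'a topology \<Rightarrow>
     ('g::topological_group_add \<Rightarrow> 'a \<Rightarrow> 'a) \<Rightarrow> bool" where
  "dynamical_system smul T \<alpha> \<longleftrightarrow>
     locally_convex_algebra smul T \<and>
     (\<forall>g. algebra_automorphism smul (\<alpha> g)) \<and>
     (\<forall>g h. \<alpha> (g + h) = \<alpha> g \<circ> \<alpha> h) \<and>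
     continuous_map (prod_topology euclidean T) T (\<lambda>(g, a). \<alpha> g a)"

definition dual_group :: "('g::topological_group_add \<Rightarrow> complex) set" where
  "dual_group =
     {\<phi>. continuous_on UNIV \<phi> \<and> range \<phi> \<subseteq> sphere 0 1 \<and> (\<forall>g h. \<phi> (g + h) = \<phi> g * \<phi> h)}"

definition isotypic_component ::
    "(complex \<Rightarrow> 'a \<Rightarrow> 'a) \<Rightarrow> ('g \<Rightarrow> 'a \<Rightarrow> 'a) \<Rightarrow> ('g \<Rightarrow> complex) \<Rightarrow> 'a set" where
  "isotypic_component smul \<alpha> \<phi> = {a. \<forall>g. \<alpha> g a = smul (\<phi> g) a}"

text \<open>
  A continuous representation \<open>(\<pi>, V)\<close> on a Hausdorff locally convex space with
  underlying set \<open>V = topspace T\<close>. Only the restriction of \<open>\<pi> g\<close> to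
  \<open>V\<close> is relevant.
\<close>

definition continuous_representation ::
    "(complex \<Rightarrow> 'v::ab_group_add \<Rightarrow> 'v) \<Rightarrow> 'v topology \<Rightarrow>
     ('g::topological_group_add \<Rightarrow> 'v \<Rightarrow> 'v) \<Rightarrow> bool" where
  "continuous_representation smul T \<pi> \<longleftrightarrow>
     locally_convex_space smul T \<and>
     Hausdorff_space T \<and>
     (\<forall>g. \<forall>u\<in>topspace T. \<forall>v\<in>topspace T. \<pi> g (u + v) = \<pi> g u + \<pi> g v) \<and>
     (\<forall>g c. \<forall>v\<in>topspace T. \<pi> g (smul c v) = smul c (\<pi> g v)) \<and>
     (\<forall>v\<in>topspace T. \<pi> 0 v = v) \<and>
     (\<forall>g h. \<forall>v\<in>topspace T. \<pi> (g + h) v = \<pi> g (\<pi> h v)) \<and>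
     continuous_map (prod_topology euclidean T) T (\<lambda>(g, v). \<pi> g v)"


section \<open>The algebraic tensor product\<close>

text \<open>
  \<^typ>\<open>'b \<Rightarrow>\<^sub>0 complex\<close> is the free complex vector space on \<open>'b\<close>, with basis
  \<open>Poly_Mapping.single x 1\<close>. The tensor product \<open>A \<otimes> V\<close> of (the type of) \<open>A\<close> with a
  subspace \<open>V\<close> is the quotient of the free vector space on \<open>A \<times> V\<close> by the span of the
  bilinearity relators; its elements are equivalence classes.
\<close>

definition free_scale :: "complex \<Rightarrow> ('b \<Rightarrow>\<^sub>0 complex) \<Rightarrow> ('b \<Rightarrow>\<^sub>0 complex)" where
  "free_scale c = Poly_Mapping.map (\<lambda>x. c * x)"

definition linear_extension ::
    "(complex \<Rightarrow> 'v::ab_group_add \<Rightarrow> 'v) \<Rightarrow> ('b \<Rightarrow> 'v) \<Rightarrow> ('b \<Rightarrow>\<^sub>0 complex) \<Rightarrow> 'v" where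
  "linear_extension smul h f =
     (\<Sum>x\<in>Poly_Mapping.keys f. smul (Poly_Mapping.lookup f x) (h x))"

abbreviation free_gen :: "'a \<Rightarrow> 'v \<Rightarrow> ('a \<times> 'v \<Rightarrow>\<^sub>0 complex)" where
  "free_gen a v \<equiv> Poly_Mapping.single (a, v) 1"

definition tensor_relators ::
    "(complex \<Rightarrow> 'a::ab_group_add \<Rightarrow> 'a) \<Rightarrow> (complex \<Rightarrow> 'v::ab_group_add \<Rightarrow> 'v) \<Rightarrow> 'v set \<Rightarrow>
     ('a \<times> 'v \<Rightarrow>\<^sub>0 complex) set" where
  "tensor_relators sA sV V =
     {free_gen (a + b) v - free_gen a v - free_gen b v | a b v. v \<in> V} \<union>
     {free_gen a (u + v) - free_gen a u - free_gen a v | a u v. u \<in> V \<and> v \<in> V} \<union>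
     {free_gen (sA c a) v - free_scale c (free_gen a v) | c a v. v \<in> V} \<union>
     {free_gen a (sV c v) - free_scale c (free_gen a v) | c a v. v \<in> V}"

definition free_tensors :: "'v set \<Rightarrow> ('a \<times> 'v \<Rightarrow>\<^sub>0 complex) set" where
  "free_tensors V = {f. Poly_Mapping.keys f \<subseteq> UNIV \<times> V}"

definition tensor_rel ::
    "(complex \<Rightarrow> 'a::ab_group_add \<Rightarrow> 'a) \<Rightarrow> (complex \<Rightarrow> 'v::ab_group_add \<Rightarrow> 'v) \<Rightarrow> 'v set \<Rightarrow>
     (('a \<times> 'v \<Rightarrow>\<^sub>0 complex) \<times> ('a \<times> 'v \<Rightarrow>\<^sub>0 complex)) set" where
  "tensor_rel sA sV V =
     {(f, h). f \<in> free_tensors V \<and> h \<in> free_tensors V \<and>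
              f - h \<in> module.span free_scale (tensor_relators sA sV V)}"

definition tensor_space ::
    "(complex \<Rightarrow> 'a::ab_group_add \<Rightarrow> 'a) \<Rightarrow> (complex \<Rightarrow> 'v::ab_group_add \<Rightarrow> 'v) \<Rightarrow> 'v set \<Rightarrow>
     ('a \<times> 'v \<Rightarrow>\<^sub>0 complex) set set" where
  "tensor_space sA sV V = free_tensors V // tensor_rel sA sV V"

text \<open>
  The map \<open>F \<otimes> H\<close> on \<open>A \<otimes> V\<close>, for linear \<open>F : A \<rightarrow> A\<close> and \<open>H : V \<rightarrow> V\<close>, and the map
  \<open>\<xi> \<otimes> id : A \<otimes> V \<rightarrow> \<complex> \<otimes> V = V\<close>. They are independent of representatives by
  \<open>tensor_map_class\<close> and \<open>tensor_eval_class\<close> below.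
\<close>

definition free_map ::
    "('a \<Rightarrow> 'a) \<Rightarrow> ('v \<Rightarrow> 'v) \<Rightarrow> ('a \<times> 'v \<Rightarrow>\<^sub>0 complex) \<Rightarrow> ('a \<times> 'v \<Rightarrow>\<^sub>0 complex)" where
  "free_map F H = linear_extension free_scale (\<lambda>(a, v). free_gen (F a) (H v))"

definition tensor_map ::
    "(complex \<Rightarrow> 'a::ab_group_add \<Rightarrow> 'a) \<Rightarrow> (complex \<Rightarrow> 'v::ab_group_add \<Rightarrow> 'v) \<Rightarrow> 'v set \<Rightarrow>
     ('a \<Rightarrow> 'a) \<Rightarrow> ('v \<Rightarrow> 'v) \<Rightarrow> ('a \<times> 'v \<Rightarrow>\<^sub>0 complex) set \<Rightarrow> ('a \<times> 'v \<Rightarrow>\<^sub>0 complex) set" where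
  "tensor_map sA sV V F H X = tensor_rel sA sV V `` (free_map F H ` X)"

definition free_eval ::
    "(complex \<Rightarrow> 'v::ab_group_add \<Rightarrow> 'v) \<Rightarrow> ('a \<Rightarrow> complex) \<Rightarrow> ('a \<times> 'v \<Rightarrow>\<^sub>0 complex) \<Rightarrow> 'v" where
  "free_eval sV \<xi> = linear_extension sV (\<lambda>(a, v). sV (\<xi> a) v)"

definition tensor_eval ::
    "(complex \<Rightarrow> 'v::ab_group_add \<Rightarrow> 'v) \<Rightarrow> ('a \<Rightarrow> complex) \<Rightarrow> ('a \<times> 'v \<Rightarrow>\<^sub>0 complex) set \<Rightarrow> 'v" where
  "tensor_eval sV \<xi> X = the_elem (free_eval sV \<xi> ` X)"

lemma lookup_free_scale [simp]:
  "Poly_Mapping.lookup (free_scale c f) x = c * Poly_Mapping.lookup f x"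
  by (simp add: free_scale_def Poly_Mapping.map.rep_eq when_def)

lemma vector_space_free_scale: "vector_space free_scale"
  by standard (auto intro!: poly_mapping_eqI simp: lookup_add algebra_simps)

interpretation free_vs: vector_space free_scale
  by (rule vector_space_free_scale)

lemma linear_extension_superset:
  assumes "vector_space smul" "finite S" "Poly_Mapping.keys f \<subseteq> S"
  shows "linear_extension smul h f = (\<Sum>x\<in>S. smul (Poly_Mapping.lookup f x) (h x))"
proof -
  interpret vector_space smul by fact
  show ?thesis
    unfolding linear_extension_def
    by (rule sum.mono_neutral_left) (use assms in \<open>auto simp: in_keys_iff\<close>)
qed

lemma linear_linear_extension:
  assumes "vector_space smul"
  shows "Vector_Spaces.linear free_scale smul (linear_extension smul h)"
proof -
  interpret vector_space smul by fact
  show ?thesis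
  proof (intro Vector_Spaces.linear.intro module_hom.intro module_hom_axioms.intro)
    fix f g :: "'b \<Rightarrow>\<^sub>0 complex"
    let ?S = "Poly_Mapping.keys f \<union> Poly_Mapping.keys g"
    have "Poly_Mapping.keys (f + g) \<subseteq> ?S" by (rule Poly_Mapping.keys_add)
    then show "linear_extension smul h (f + g) = linear_extension smul h f + linear_extension smul h g"
      by (simp add: linear_extension_superset[OF assms, where S = ?S] lookup_add
          scale_left_distrib sum.distrib)
  next
    fix c and f :: "'b \<Rightarrow>\<^sub>0 complex"
    have "Poly_Mapping.keys (free_scale c f) \<subseteq> Poly_Mapping.keys f"
      by (auto simp: in_keys_iff)
    then show "linear_extension smul h (free_scale c f) = smul c (linear_extension smul h f)"
      by (simp add: linear_extension_superset[OF assms, where S = "Poly_Mapping.keys f"]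
          scale_sum_right)
  qed unfold_locales
qed

lemma linear_extension_single [simp]:
  assumes "vector_space smul"
  shows "linear_extension smul h (Poly_Mapping.single x 1) = h x"
proof -
  interpret vector_space smul by fact
  show ?thesis by (simp add: linear_extension_def)
qed

lemma equiv_tensor_rel: "equiv (free_tensors V) (tensor_rel sA sV V)"
proof (rule equivI)
  show "refl_on (free_tensors V) (tensor_rel sA sV V)"
    by (auto simp: refl_on_def tensor_rel_def free_vs.span_zero)
  show "sym (tensor_rel sA sV V)"
    unfolding sym_def tensor_rel_def by (auto dest: free_vs.span_neg)
  show "trans (tensor_rel sA sV V)"
  proof (rule transI)
    fix f g h
    assume "(f, g) \<in> tensor_rel sA sV V" "(g, h) \<in> tensor_rel sA sV V"
    then show "(f, h) \<in> tensor_rel sA sV V"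
      unfolding tensor_rel_def using free_vs.span_add[of "f - g" _ "g - h"] by simp
  qed
qed (auto simp: tensor_rel_def)

lemma free_map_tensor_rel:
  assumes F: "Vector_Spaces.linear sA sA F"
    and HV: "\<And>v. v \<in> V \<Longrightarrow> H v \<in> V"
    and Hadd: "\<And>u v. u \<in> V \<Longrightarrow> v \<in> V \<Longrightarrow> H (u + v) = H u + H v"
    and Hscale: "\<And>c v. v \<in> V \<Longrightarrow> H (sV c v) = sV c (H v)"
    and fh: "(f, h) \<in> tensor_rel sA sV V"
  shows "(free_map F H f, free_map F H h) \<in> tensor_rel sA sV V"
proof -
  interpret F: Vector_Spaces.linear sA sA F by fact
  interpret E: Vector_Spaces.linear free_scale free_scale "free_map F H"
    unfolding free_map_def by (rule linear_linear_extension[OF vector_space_free_scale])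
  have gen: "free_map F H (free_gen a v) = free_gen (F a) (H v)" for a v
    by (simp add: free_map_def linear_extension_single[OF vector_space_free_scale])
  have keys: "free_map F H k \<in> free_tensors V" if "k \<in> free_tensors V" for k
  proof -
    have "Poly_Mapping.keys (free_map F H k) \<subseteq>
        (\<Union>x\<in>Poly_Mapping.keys k. Poly_Mapping.keys
          (free_scale (Poly_Mapping.lookup k x) (case x of (a, v) \<Rightarrow> free_gen (F a) (H v))))"
      unfolding free_map_def linear_extension_def by (rule Poly_Mapping.keys_sum)
    also have "\<dots> \<subseteq> UNIV \<times> V"
      using that HV by (fastforce simp: free_tensors_def in_keys_iff lookup_single when_def split: if_splits)
    finally show ?thesis by (simp add: free_tensors_def)
  qed
  have "free_map F H ` tensor_relators sA sV V \<subseteq> tensor_relators sA sV V"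
  proof
    fix y assume "y \<in> free_map F H ` tensor_relators sA sV V"
    then obtain x where x: "x \<in> tensor_relators sA sV V" and y: "y = free_map F H x" by blast
    from x consider
        (1) a b v where "v \<in> V" "x = free_gen (a + b) v - free_gen a v - free_gen b v"
      | (2) a u v where "u \<in> V" "v \<in> V" "x = free_gen a (u + v) - free_gen a u - free_gen a v"
      | (3) c a v where "v \<in> V" "x = free_gen (sA c a) v - free_scale c (free_gen a v)"
      | (4) c a v where "v \<in> V" "x = free_gen a (sV c v) - free_scale c (free_gen a v)"
      unfolding tensor_relators_def by blast
    then show "y \<in> tensor_relators sA sV V"
    proof cases
      case 1 then show ?thesis
        unfolding y tensor_relators_def by (simp add: E.diff gen F.add) (use HV in blast)
    next
      case 2 then show ?thesis
        unfolding y tensor_relators_def by (simp add: E.diff gen Hadd) (use HV in blast)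
    next
      case 3 then show ?thesis
        unfolding y tensor_relators_def by (simp add: E.diff E.scale gen F.scale) (use HV in blast)
    next
      case 4 then show ?thesis
        unfolding y tensor_relators_def by (simp add: E.diff E.scale gen Hscale) (use HV in blast)
    qed
  qed
  then have "free_map F H ` free_vs.span (tensor_relators sA sV V) \<subseteq>
      free_vs.span (tensor_relators sA sV V)"
    by (metis E.span_image free_vs.span_mono)
  with fh keys show ?thesis
    unfolding tensor_rel_def by (auto simp flip: E.diff)
qed

lemma tensor_map_class:
  assumes "Vector_Spaces.linear sA sA F"
    and "\<And>v. v \<in> V \<Longrightarrow> H v \<in> V"
    and "\<And>u v. u \<in> V \<Longrightarrow> v \<in> V \<Longrightarrow> H (u + v) = H u + H v"
    and "\<And>c v. v \<in> V \<Longrightarrow> H (sV c v) = sV c (H v)"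
    and f: "f \<in> free_tensors V"
  shows "tensor_map sA sV V F H (tensor_rel sA sV V `` {f}) = tensor_rel sA sV V `` {free_map F H f}"
proof -
  have *: "(free_map F H k, free_map F H h) \<in> tensor_rel sA sV V"
    if "(k, h) \<in> tensor_rel sA sV V" for k h
    by (rule free_map_tensor_rel[of sA F V H sV]) (fact assms that)+
  have "(f, f) \<in> tensor_rel sA sV V"
    using f equiv_tensor_rel[of V sA sV] by (auto simp: equiv_def refl_on_def)
  then have f_in: "free_map F H f \<in> free_map F H ` (tensor_rel sA sV V `` {f})"
    by blast
  have "tensor_rel sA sV V `` {k} = tensor_rel sA sV V `` {free_map F H f}"
    if "k \<in> free_map F H ` (tensor_rel sA sV V `` {f})" for k
    using that * by (metis (no_types, lifting) Image_singleton_iff equiv_class_eq equiv_tensor_rel imageE)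
  then have "(\<Union>k\<in>free_map F H ` (tensor_rel sA sV V `` {f}). tensor_rel sA sV V `` {k}) =
      tensor_rel sA sV V `` {free_map F H f}"
    using f_in by blast
  then show ?thesis
    unfolding tensor_map_def by (subst Image_eq_UN)
qed

lemma tensor_eval_class:
  assumes V: "vector_space sV" and \<xi>: "Vector_Spaces.linear sA (*) \<xi>" and f: "f \<in> free_tensors V"
  shows "tensor_eval sV \<xi> (tensor_rel sA sV V `` {f}) = free_eval sV \<xi> f"
proof -
  interpret V: vector_space sV by fact
  interpret \<xi>: Vector_Spaces.linear sA "(*)" \<xi> by fact
  interpret E: Vector_Spaces.linear free_scale sV "free_eval sV \<xi>"
    unfolding free_eval_def by (rule linear_linear_extension[OF V])
  have gen: "free_eval sV \<xi> (free_gen a v) = sV (\<xi> a) v" for a v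
    by (simp add: free_eval_def linear_extension_single[OF V])
  have "free_eval sV \<xi> x = 0" if "x \<in> tensor_relators sA sV V" for x
    using that unfolding tensor_relators_def
    by (auto simp: E.diff E.scale gen \<xi>.add \<xi>.scale V.scale_left_distrib V.scale_right_distrib
        mult.commute)
  then have 0: "free_eval sV \<xi> x = 0" if "x \<in> free_vs.span (tensor_relators sA sV V)" for x
    using E.eq_0_on_span that by blast
  have "free_eval sV \<xi> h = free_eval sV \<xi> f" if "(f, h) \<in> tensor_rel sA sV V" for h
    using that 0[of "f - h"] by (auto simp: tensor_rel_def E.diff)
  moreover have "(f, f) \<in> tensor_rel sA sV V"
    using f equiv_tensor_rel[of V sA sV] by (auto simp: equiv_def refl_on_def)
  ultimately have "free_eval sV \<xi> ` (tensor_rel sA sV V `` {f}) = {free_eval sV \<xi> f}"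
    by (intro equalityI subsetI) (blast, blast)
  then show ?thesis by (simp add: tensor_eval_def)
qed


section \<open>Free dynamical systems\<close>

text \<open>The space \<open>\<Gamma>\<^sub>A V\<close>.\<close>

definition equivariant_tensors ::
    "(complex \<Rightarrow> 'a::ab_group_add \<Rightarrow> 'a) \<Rightarrow> ('g::group_add \<Rightarrow> 'a \<Rightarrow> 'a) \<Rightarrow>
     (complex \<Rightarrow> 'v::ab_group_add \<Rightarrow> 'v) \<Rightarrow> 'v set \<Rightarrow> ('g \<Rightarrow> 'v \<Rightarrow> 'v) \<Rightarrow>
     ('a \<times> 'v \<Rightarrow>\<^sub>0 complex) set set" where
  "equivariant_tensors sA \<alpha> sV V \<pi> =
     {s \<in> tensor_space sA sV V.
        \<forall>g. tensor_map sA sV V (\<alpha> g) id s = tensor_map sA sV V id (\<pi> (- g)) s}"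

text \<open>
  A family of representations enters freeness only through its set of members, so it is a set
  \<open>R\<close> of pairs of a topology (with \<open>V = topspace T\<close>) and an action.

  HOL cannot quantify over all types inside a formula, so the spaces \<open>V\<close> range over the linear
  subspaces, each with an arbitrary locally convex topology, of the free vector space
  \<open>U\<close> on \<open>G \<times> \<complex>\<^sup>A\<close>. This is no restriction: let any family witnessing
  freeness be given, and let \<open>\<pi> g v \<noteq> v\<close> in a member \<open>(\<pi>, V)\<close> of it. Starting from
  \<open>v\<close>, repeatedly close under linear combinations, under the action of \<open>G\<close>, and, for
  each basis vector \<open>w\<close> obtained so far and each character \<open>\<xi>\<close>, under adjoining the
  finitely many \<open>V\<close>-components of some \<open>s \<in> \<Gamma>\<^sub>A V\<close> that \<open>\<xi> \<otimes> id\<close> maps to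
  \<open>w\<close>. The union of these steps is an invariant subspace \<open>V'\<close> containing \<open>v\<close>, for
  which all the maps \<open>\<Gamma>\<^sub>A V' \<rightarrow> V'\<close> are surjective, and which has dimension at most
  \<open>max (\<aleph>\<^sub>0, |G|, |\<Gamma>\<^sub>A|) \<le> |G \<times> \<complex>\<^sup>A|\<close>. So \<open>V'\<close> is isomorphic to a subspace
  of \<open>U\<close>, and the subspaces \<open>V'\<close>, one for each \<open>g\<close> other than the neutral element,
  form a family as required.
\<close>

type_synonym ('a, 'g) rep_universe = "'g \<times> ('a \<Rightarrow> complex) \<Rightarrow>\<^sub>0 complex"

definition free_system ::
    "(complex \<Rightarrow> 'a::{comm_ring, monoid_mult} \<Rightarrow> 'a) \<Rightarrow> 'a topology \<Rightarrow>
     ('g::topological_group_add \<Rightarrow> 'a \<Rightarrow> 'a) \<Rightarrow> bool" where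
  "free_system sA TA \<alpha> \<longleftrightarrow>
     dynamical_system sA TA \<alpha> \<and>
     (\<exists>R :: (('a, 'g) rep_universe topology \<times>
              ('g \<Rightarrow> ('a, 'g) rep_universe \<Rightarrow> ('a, 'g) rep_universe)) set.
        (\<forall>(T, \<pi>)\<in>R. continuous_representation free_scale T \<pi>) \<and>
        (\<forall>g. g \<noteq> 0 \<longrightarrow> (\<exists>(T, \<pi>)\<in>R. \<exists>v\<in>topspace T. \<pi> g v \<noteq> v)) \<and>
        (\<forall>(T, \<pi>)\<in>R. \<forall>\<xi>\<in>characters sA.
           tensor_eval free_scale \<xi> ` equivariant_tensors sA \<alpha> free_scale (topspace T) \<pi>
             = topspace T))"

end

theory Submission
  imports Defs
begin

text \<open>
  A continuous character \<open>\<phi>\<close> of \<open>G\<close> is a continuous representation on the complex line. An element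
  of \<open>A \<otimes> \<complex> = A\<close> is equivariant for it exactly if it lies in the isotypic component of
  \<open>\<phi>\<^sup>-\<^sup>1\<close>, and \<open>\<xi> \<otimes> id\<close> then becomes \<open>\<xi>\<close>. So the
  hypothesis says precisely that these one-dimensional representations satisfy the
  surjectivity condition of freeness (\<open>character_evaluation_surjective\<close>), and what is left is
  that the continuous characters of a compact abelian group separate its points
  (\<open>dual_group_separates_points\<close>). This is the Peter-Weyl theorem for abelian groups, and it is
  where the work lies.

  The proof of separation avoids measure theory and compact operators. An invariant mean on
  continuous functions comes from finite averages of translates: by compactness, suitable averages
  of a continuous function oscillate arbitrarily little (\<open>averages_flatten_Re\<close>). The mean makes
  the continuous functions a commutative algebra under convolution, with an inner product. For a
  hermitian \<open>v \<noteq> 0\<close>, the functions \<open>v\<^sup>2\<^sup>n\<close>, divided by the \<open>n\<close>-th power of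
  the growth rate \<open>l\<close> of \<open>\<parallel>v\<^sup>n\<parallel>\<^sup>2\<close>, converge uniformly to an idempotent
  \<open>p \<noteq> 0\<close> (\<open>spectral_idempotent\<close>); it is the kernel of the projection
  onto the top eigenspace of convolution by \<open>v\<^sup>2\<close>, with eigenvalue \<open>l\<close>. Idempotents have
  \<open>\<parallel>p\<parallel>\<^sup>2 \<ge> 1\<close>, so \<open>\<parallel>p\<parallel>\<^sup>2\<close> drops by at least \<open>1\<close> on a proper
  sub-idempotent and there is a minimal one, \<open>q\<close>, below \<open>p\<close>. The ideal that \<open>q\<close> generates is
  one-dimensional, so the translates of \<open>q\<close> are multiples \<open>\<phi> g \<sqdot> q\<close> of \<open>q\<close>, and \<open>\<phi>\<close>
  is a character (\<open>character_below_idempotent\<close>).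

  To get \<open>\<phi> g \<noteq> 1\<close> for a given \<open>g \<noteq> 0\<close>, take a continuous \<open>h\<close> with \<open>h 0 \<noteq> h g\<close>
  and \<open>v = u * u\<^sup>*\<close> for the difference \<open>u\<close> of \<open>h\<close> and its translate by \<open>g\<close>. If
  \<open>\<phi> g = 1\<close>, then \<open>u * q = 0\<close>, whereas \<open>v\<^sup>2 * q = l q \<noteq> 0\<close>.
\<close>

section \<open>The invariant mean of a compact abelian group\<close>

text \<open>
  The convex combinations of translations, which are the averages with finitely many weights.
  Generating them by binary mixing and composition makes their common properties one-line
  inductions.
\<close>

inductive averaging :: "(('g::ab_group_add \<Rightarrow> complex) \<Rightarrow> 'g \<Rightarrow> complex) \<Rightarrow> bool" where
  shift: "averaging (\<lambda>f x. f (x + g))"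
| mix: "averaging A \<Longrightarrow> averaging B \<Longrightarrow> 0 \<le> t \<Longrightarrow> t \<le> 1 \<Longrightarrow>
    averaging (\<lambda>f x. of_real t * A f x + of_real (1 - t) * B f x)"
| comp: "averaging A \<Longrightarrow> averaging B \<Longrightarrow> averaging (\<lambda>f. A (B f))"

lemma averaging_add: "averaging A \<Longrightarrow> A (\<lambda>x. f x + h x) = (\<lambda>x. A f x + A h x)"
  by (induction arbitrary: f h rule: averaging.induct) (auto simp: algebra_simps)

lemma averaging_scale: "averaging A \<Longrightarrow> A (\<lambda>x. c * f x) = (\<lambda>x. c * A f x)"
  by (induction arbitrary: f rule: averaging.induct) (auto simp: algebra_simps)

lemma averaging_const: "averaging A \<Longrightarrow> A (\<lambda>_. c) = (\<lambda>_. c)"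
  by (induction rule: averaging.induct) (auto simp: algebra_simps)

lemma averaging_diff: "averaging A \<Longrightarrow> A (\<lambda>x. f x - h x) = (\<lambda>x. A f x - A h x)"
  using averaging_add[of A f "\<lambda>x. (-1) * h x"] averaging_scale[of A "-1" h] by simp

lemma averaging_diff_const: "averaging A \<Longrightarrow> A (\<lambda>x. f x - c) = (\<lambda>x. A f x - c)"
  by (simp add: averaging_diff[of A f] averaging_const)

lemma averaging_shift: "averaging A \<Longrightarrow> A (\<lambda>x. f (x + g)) = (\<lambda>x. A f (x + g))"
  by (induction arbitrary: f rule: averaging.induct) (auto simp: add_ac)

text \<open>
  Averages that are good for different functions are combined by composing them, in either order;
  this is what commutativity of the group is needed for.
\<close>

lemma averaging_commute: "averaging A \<Longrightarrow> averaging B \<Longrightarrow> A (B f) = B (A f)"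
proof (induction arbitrary: f rule: averaging.induct)
  case (shift g)
  then show ?case by (simp add: averaging_shift)
next
  case (mix A A' t)
  then show ?case by (simp add: averaging_add[OF mix.prems] averaging_scale[OF mix.prems])
qed auto

lemma averaging_norm_le: "averaging A \<Longrightarrow> (\<And>x. norm (f x) \<le> M) \<Longrightarrow> norm (A f x) \<le> M"
proof (induction arbitrary: f x rule: averaging.induct)
  case (mix A B t)
  have "norm (of_real t * A f x + of_real (1 - t) * B f x) \<le>
      norm (of_real t * A f x) + norm (of_real (1 - t) * B f x)"
    by (rule norm_triangle_ineq)
  also have "\<dots> = t * norm (A f x) + (1 - t) * norm (B f x)"
    using mix.hyps by (simp add: norm_mult flip: of_real_diff)
  also have "\<dots> \<le> M"
    using mix by (intro convex_bound_le) auto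
  finally show ?case .
qed auto

lemma averaging_Re_le: "averaging A \<Longrightarrow> (\<And>x. Re (f x) \<le> M) \<Longrightarrow> Re (A f x) \<le> M"
proof (induction arbitrary: f x rule: averaging.induct)
  case (mix A B t)
  have "t * Re (A f x) + (1 - t) * Re (B f x) \<le> M"
    using mix by (intro convex_bound_le) auto
  then show ?case by (simp flip: of_real_diff)
qed auto

lemma averaging_continuous:
  fixes A :: "('g::topological_ab_group_add \<Rightarrow> complex) \<Rightarrow> 'g \<Rightarrow> complex"
  shows "averaging A \<Longrightarrow> continuous_on UNIV f \<Longrightarrow> continuous_on UNIV (A f)"
proof (induction arbitrary: f rule: averaging.induct)
  case (shift g)
  then show ?case by (rule continuous_on_compose2) (auto intro!: continuous_intros)
qed (auto intro!: continuous_intros simp del: of_real_diff)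

lemma averaging_translates:
  assumes "finite F" "F \<noteq> {}"
  shows "averaging (\<lambda>f x. (\<Sum>g\<in>F. f (x + g)) / of_nat (card F))"
  using assms
proof (induction rule: finite_ne_induct)
  case (singleton g)
  then show ?case using averaging.shift[of g] by simp
next
  case (insert g F)
  define n where "n = card F"
  have n: "n > 0" using insert by (simp add: n_def card_gt_0_iff)
  have "averaging (\<lambda>f x. of_real (1 / (1 + real n)) * f (x + g) +
      of_real (1 - 1 / (1 + real n)) * ((\<Sum>g\<in>F. f (x + g)) / of_nat (card F)))"
    by (rule averaging.mix[OF averaging.shift insert.IH]) auto
  also have "(\<lambda>(f :: 'a \<Rightarrow> complex) x. of_real (1 / (1 + real n)) * f (x + g) +
      of_real (1 - 1 / (1 + real n)) * ((\<Sum>g\<in>F. f (x + g)) / of_nat (card F))) =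
      (\<lambda>f x. (\<Sum>g\<in>insert g F. f (x + g)) / of_nat (card (insert g F)))"
  proof (intro ext)
    fix f :: "'a \<Rightarrow> complex" and x
    have c: "1 + of_nat n \<noteq> (0::complex)" by (metis of_nat_Suc of_nat_eq_0_iff nat.distinct(2))
    have e: "complex_of_real (1 - 1 / (1 + real n)) = of_nat n / (1 + of_nat n)"
      using c by (simp add: field_simps)
    show "of_real (1 / (1 + real n)) * f (x + g) +
      of_real (1 - 1 / (1 + real n)) * ((\<Sum>g\<in>F. f (x + g)) / of_nat (card F)) =
      (\<Sum>g\<in>insert g F. f (x + g)) / of_nat (card (insert g F))"
      unfolding e using insert.hyps n c by (simp add: n_def[symmetric] add_divide_distrib)
  qed
  finally show ?case .
qed

lemma finitely_many_translates_cover: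
  fixes U :: "'g::topological_ab_group_add set"
  assumes K: "compact (UNIV :: 'g set)" and U: "open U" "u \<in> U"
  obtains F where "finite F" "F \<noteq> {}" "\<And>x. \<exists>g\<in>F. x + g \<in> U"
proof -
  have op: "open ((\<lambda>x. x + g) -` U)" for g
    by (rule open_vimage[OF U(1)]) (auto intro!: continuous_intros)
  have "UNIV \<subseteq> (\<Union>g\<in>UNIV. (\<lambda>x. x + g) -` U)"
  proof
    fix x show "x \<in> (\<Union>g\<in>UNIV. (\<lambda>x. x + g) -` U)"
      using U(2) by (auto intro!: exI[of _ "u - x"])
  qed
  then obtain F where F: "finite F" "UNIV \<subseteq> (\<Union>g\<in>F. (\<lambda>x. x + g) -` U)"
    using compactE_image[OF K, of UNIV "\<lambda>g. (\<lambda>x. x + g) -` U"] op by metis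
  show thesis
    by (rule that[of F]) (use F in auto)
qed

text \<open>
  Uniform continuity in a form that mentions only translations, so that it passes to averages
  with the same \<open>U\<close>.
\<close>

lemma uniformly_continuous_translation:
  fixes f :: "'g::topological_ab_group_add \<Rightarrow> complex"
  assumes K: "compact (UNIV :: 'g set)" and f: "continuous_on UNIV f" and "\<epsilon> > 0"
  obtains U where "open U" "0 \<in> U" "\<And>d x. d \<in> U \<Longrightarrow> norm (f (x + d) - f x) \<le> \<epsilon>"
proof -
  have "continuous_on (UNIV \<times> UNIV) (\<lambda>(d, x). f (x + d))"
    unfolding split_beta by (rule continuous_on_compose2[OF f]) (auto intro!: continuous_intros)
  from continuous_on_prod_compactE[OF this K _ \<open>\<epsilon> > 0\<close>, of 0]
  obtain U where "0 \<in> U" "open U" "\<forall>d\<in>U \<inter> UNIV. \<forall>x\<in>UNIV. dist (f (x + d)) (f (x + 0)) \<le> \<epsilon>"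
    by auto
  then show thesis by (intro that[of U]) (auto simp: dist_norm)
qed

lemma bounded_continuous_compact:
  fixes f :: "'g::topological_space \<Rightarrow> complex"
  assumes K: "compact (UNIV :: 'g set)" and f: "continuous_on UNIV f"
  obtains B where "B > 0" "\<And>x. norm (f x) \<le> B"
  using compact_imp_bounded[OF compact_continuous_image[OF f K]] by (auto simp: bounded_pos)

text \<open>
  \<open>M\<close> is the infimum of the suprema of all averages. Suppose that an average is nowhere larger than
  \<open>M + \<delta>\<close> but noticeably smaller than \<open>M\<close> at \<open>x0\<close>. By equicontinuity it is then small on a
  neighbourhood \<open>x0 + U\<close>, whose size does not depend on the average. Averaging further over the
  \<open>n\<close> translations of a cover lets every point see this dip with weight \<open>1 / n\<close>, and brings the
  supremum below \<open>M\<close> if \<open>\<delta>\<close> is small compared with \<open>1 / n\<close>.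
\<close>

lemma averages_flatten_Re:
  fixes f :: "'g::topological_ab_group_add \<Rightarrow> complex"
  assumes K: "compact (UNIV :: 'g set)" and f: "continuous_on UNIV f"
  obtains M where "\<And>\<epsilon>. \<epsilon> > 0 \<Longrightarrow> \<exists>A. averaging A \<and> (\<forall>x. \<bar>Re (A f x) - M\<bar> \<le> \<epsilon>)"
proof -
  define S where "S = {M. \<exists>A. averaging A \<and> (\<forall>x. Re (A f x) \<le> M)}"
  obtain B where B: "\<And>x. norm (f x) \<le> B" using bounded_continuous_compact[OF K f] by metis
  have "averaging (\<lambda>f x::'g. f (x + 0) :: complex)" by (rule averaging.shift)
  moreover have "Re (f x) \<le> B" for x
    using B[of x] complex_Re_le_cmod[of "f x"] by linarith
  ultimately have ne: "B \<in> S" by (auto simp: S_def)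
  have lower: "- B \<le> M" if "M \<in> S" for M
  proof -
    from that obtain A where A: "averaging A" "\<And>x. Re (A f x) \<le> M" by (auto simp: S_def)
    have "norm (A f 0) \<le> B" by (rule averaging_norm_le[OF A(1) B])
    with A(2)[of 0] abs_Re_le_cmod[of "A f 0"] show ?thesis by linarith
  qed
  then have bdd: "bdd_below S" by (rule bdd_belowI)
  define M where "M = Inf S"
  have M_le: "M \<le> N" if "N \<in> S" for N unfolding M_def using that bdd by (rule cInf_lower)
  show thesis
  proof (rule that[of M])
    fix \<epsilon> :: real assume \<epsilon>: "\<epsilon> > 0"
    then have "\<epsilon> / 2 > 0" by simp
    from uniformly_continuous_translation[OF K f this]
    obtain U where U: "open U" "0 \<in> U" "\<And>d x. d \<in> U \<Longrightarrow> norm (f (x + d) - f x) \<le> \<epsilon> / 2"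
      by metis
    from finitely_many_translates_cover[OF K U(1,2)]
    obtain F where F: "finite F" "F \<noteq> {}" "\<And>x. \<exists>g\<in>F. x + g \<in> U" by metis
    define n where "n = real (card F)"
    have n: "n \<ge> 1" using F by (auto simp: n_def Suc_le_eq card_gt_0_iff)
    \<comment> \<open>The dip of depth \<open>\<epsilon> / 2\<close>, weighted by \<open>1 / n\<close>, has to outweigh the excess \<open>\<delta>\<close>.\<close>
    define \<delta> where "\<delta> = \<epsilon> / (2 * n)"
    have \<delta>: "\<delta> > 0" using n \<epsilon> by (simp add: \<delta>_def)
    have n\<delta>: "n * \<delta> = \<epsilon> / 2" using n by (simp add: \<delta>_def)
    have "\<exists>N\<in>S. N < M + \<delta>"
      using cInf_lessD[of S "M + \<delta>"] ne \<delta> by (auto simp: M_def)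
    then obtain A where A: "averaging A" "\<And>x. Re (A f x) \<le> M + \<delta>"
      unfolding S_def by (smt (verit) mem_Collect_eq)
    have mod: "norm (A f (x + d) - A f x) \<le> \<epsilon> / 2" if "d \<in> U" for d x
    proof -
      have "A f (x + d) - A f x = A (\<lambda>x. f (x + d) - f x) x"
        by (simp add: averaging_diff[OF A(1)] averaging_shift[OF A(1)])
      also have "norm \<dots> \<le> \<epsilon> / 2"
        by (rule averaging_norm_le[OF A(1)]) (rule U(3)[OF that])
      finally show ?thesis .
    qed
    have lo: "Re (A f x0) \<ge> M - \<epsilon>" for x0
    proof -
      let ?T = "\<lambda>f x. (\<Sum>g\<in>F. f (x + g)) / of_nat (card F) :: complex"
      have T: "averaging (\<lambda>f. ?T (A f))"
        by (rule averaging.comp[OF averaging_translates A(1)]) (use F in auto)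
      have "Re (?T (A f) x) \<le> ((n - 1) * (M + \<delta>) + (Re (A f x0) + \<epsilon> / 2)) / n" for x
      proof -
        obtain g where g: "g \<in> F" "x - x0 + g \<in> U" using F(3) by blast
        have "norm (A f (x0 + (x - x0 + g)) - A f x0) \<le> \<epsilon> / 2" by (rule mod[OF g(2)])
        also have "x0 + (x - x0 + g) = x + g" by simp
        finally have 1: "Re (A f (x + g)) \<le> Re (A f x0) + \<epsilon> / 2"
          using abs_Re_le_cmod[of "A f (x + g) - A f x0"] by simp
        have "(\<Sum>g\<in>F - {g}. Re (A f (x + g))) \<le> (\<Sum>g\<in>F - {g}. M + \<delta>)"
          by (rule sum_mono) (rule A(2))
        also have "\<dots> = (n - 1) * (M + \<delta>)"
          using F(1) g n by (simp add: n_def card_Diff_singleton of_nat_diff Suc_le_eq card_gt_0_iff)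
        finally have "(\<Sum>g\<in>F. Re (A f (x + g))) \<le> (n - 1) * (M + \<delta>) + (Re (A f x0) + \<epsilon> / 2)"
          using 1 F(1) g(1) by (simp add: sum.remove)
        then show ?thesis using n by (simp add: n_def divide_right_mono)
      qed
      then have "((n - 1) * (M + \<delta>) + (Re (A f x0) + \<epsilon> / 2)) / n \<in> S"
        unfolding S_def using T by (intro CollectI exI[of _ "\<lambda>f. ?T (A f)"]) blast
      from M_le[OF this] n have "M * n \<le> (n - 1) * (M + \<delta>) + (Re (A f x0) + \<epsilon> / 2)"
        by (simp add: field_simps)
      then show ?thesis using n\<delta> \<delta> by (simp add: algebra_simps)
    qed
    have "\<delta> \<le> n * \<delta>" using n \<delta> by simp
    then have "\<delta> \<le> \<epsilon>" using n\<delta> \<epsilon> by simp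
    then have "\<bar>Re (A f x) - M\<bar> \<le> \<epsilon>" for x
      using lo[of x] A(2)[of x] by (simp add: abs_le_iff)
    with A(1) show "\<exists>A. averaging A \<and> (\<forall>x. \<bar>Re (A f x) - M\<bar> \<le> \<epsilon>)" by blast
  qed
qed

definition has_mean :: "('g::ab_group_add \<Rightarrow> complex) \<Rightarrow> complex \<Rightarrow> bool" where
  "has_mean f c \<longleftrightarrow> (\<forall>\<epsilon>>0. \<exists>A. averaging A \<and> (\<forall>x. norm (A f x - c) \<le> \<epsilon>))"

definition mean :: "('g::ab_group_add \<Rightarrow> complex) \<Rightarrow> complex" where
  "mean f = (THE c. has_mean f c)"

lemma averaging_Re_near:
  assumes "averaging A" "\<And>x. \<bar>Re (f x) - M\<bar> \<le> \<epsilon>"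
  shows "\<bar>Re (A f x) - M\<bar> \<le> \<epsilon>"
proof -
  have "Re (f x) \<le> M + \<epsilon>" "Re ((-1) * f x) \<le> \<epsilon> - M" for x
    using assms(2)[of x] by auto
  then have "Re (A f x) \<le> M + \<epsilon>" "Re (A (\<lambda>x. (-1) * f x) x) \<le> \<epsilon> - M"
    by (intro averaging_Re_le[OF assms(1)]; blast)+
  then show ?thesis by (simp only: averaging_scale[OF assms(1)]) auto
qed

lemma averaging_near:
  assumes "averaging A" "\<And>x. norm (f x - c) \<le> \<epsilon>"
  shows "norm (A f x - c) \<le> \<epsilon>"
  using averaging_norm_le[OF assms(1), of "\<lambda>x. f x - c"] assms
  by (simp add: averaging_diff_const)

text \<open>
  Real and imaginary part are flattened by different averages; since these commute, their
  composition flattens both.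
\<close>

lemma has_mean_exists:
  fixes f :: "'g::topological_ab_group_add \<Rightarrow> complex"
  assumes K: "compact (UNIV :: 'g set)" and f: "continuous_on UNIV f"
  shows "\<exists>c. has_mean f c"
proof -
  obtain M where M: "\<And>\<epsilon>. \<epsilon> > 0 \<Longrightarrow> \<exists>A. averaging A \<and> (\<forall>x. \<bar>Re (A f x) - M\<bar> \<le> \<epsilon>)"
    using averages_flatten_Re[OF K f] by metis
  have "continuous_on UNIV (\<lambda>x. - \<i> * f x)" by (intro continuous_intros f)
  from averages_flatten_Re[OF K this]
  obtain N where N: "\<And>\<epsilon>. \<epsilon> > 0 \<Longrightarrow>
    \<exists>A. averaging A \<and> (\<forall>x. \<bar>Re (A (\<lambda>x. - \<i> * f x) x) - N\<bar> \<le> \<epsilon>)" by metis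
  have "has_mean f (Complex M N)"
    unfolding has_mean_def
  proof (intro allI impI)
    fix \<epsilon> :: real assume "\<epsilon> > 0"
    then have \<epsilon>: "\<epsilon> / 2 > 0" by simp
    obtain A where A: "averaging A" "\<And>x. \<bar>Re (A f x) - M\<bar> \<le> \<epsilon> / 2" using M[OF \<epsilon>] by blast
    obtain B where B: "averaging B" "\<And>x. \<bar>Re (B (\<lambda>x. - \<i> * f x) x) - N\<bar> \<le> \<epsilon> / 2"
      using N[OF \<epsilon>] by blast
    have "norm (A (B f) x - Complex M N) \<le> \<epsilon>" for x
    proof -
      have 1: "\<bar>Re (A (B f) x) - M\<bar> \<le> \<epsilon> / 2"
        unfolding averaging_commute[OF A(1) B(1)] by (rule averaging_Re_near[OF B(1) A(2)])
      have "\<bar>Re (A (B (\<lambda>x. - \<i> * f x)) x) - N\<bar> \<le> \<epsilon> / 2"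
        by (rule averaging_Re_near[OF A(1) B(2)])
      then have 2: "\<bar>Im (A (B f) x) - N\<bar> \<le> \<epsilon> / 2"
        by (simp only: averaging_scale[OF A(1)] averaging_scale[OF B(1)]) simp
      show ?thesis using 1 2 cmod_le[of "A (B f) x - Complex M N"] by simp
    qed
    with averaging.comp[OF A(1) B(1)]
    show "\<exists>A. averaging A \<and> (\<forall>x. norm (A f x - Complex M N) \<le> \<epsilon>)" by blast
  qed
  then show ?thesis ..
qed

lemma has_mean_unique:
  assumes "has_mean f c" "has_mean f d"
  shows "c = d"
proof (rule ccontr)
  assume "c \<noteq> d"
  then have e: "norm (c - d) / 3 > 0" by simp
  obtain A where A: "averaging A" "\<And>x. norm (A f x - c) \<le> norm (c - d) / 3"
    using assms(1) e unfolding has_mean_def by blast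
  obtain B where B: "averaging B" "\<And>x. norm (B f x - d) \<le> norm (c - d) / 3"
    using assms(2) e unfolding has_mean_def by blast
  have 1: "norm (A (B f) 0 - d) \<le> norm (c - d) / 3" by (rule averaging_near[OF A(1) B(2)])
  have 2: "norm (A (B f) 0 - c) \<le> norm (c - d) / 3"
    unfolding averaging_commute[OF A(1) B(1)] by (rule averaging_near[OF B(1) A(2)])
  have "norm (c - d) \<le> norm (A (B f) 0 - d) + norm (A (B f) 0 - c)"
    using norm_triangle_ineq4[of "A (B f) 0 - d" "A (B f) 0 - c"] by simp
  with 1 2 e show False by simp
qed

lemma has_mean_mean:
  fixes f :: "'g::topological_ab_group_add \<Rightarrow> complex"
  assumes "compact (UNIV :: 'g set)" "continuous_on UNIV f"
  shows "has_mean f (mean f)"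
  unfolding mean_def using has_mean_exists[OF assms] has_mean_unique by (metis theI)

lemma has_mean_imp_mean: "has_mean f c \<Longrightarrow> mean f = c"
  unfolding mean_def using has_mean_unique by blast

lemma has_mean_add:
  assumes "has_mean f c" "has_mean h d"
  shows "has_mean (\<lambda>x. f x + h x) (c + d)"
  unfolding has_mean_def
proof (intro allI impI)
  fix \<epsilon> :: real assume "\<epsilon> > 0"
  then have \<epsilon>: "\<epsilon> / 2 > 0" by simp
  obtain A where A: "averaging A" "\<And>x. norm (A f x - c) \<le> \<epsilon> / 2"
    using assms(1) \<epsilon> unfolding has_mean_def by blast
  obtain B where B: "averaging B" "\<And>x. norm (B h x - d) \<le> \<epsilon> / 2"
    using assms(2) \<epsilon> unfolding has_mean_def by blast
  have "norm (A (B (\<lambda>x. f x + h x)) x - (c + d)) \<le> \<epsilon>" for x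
  proof -
    have 1: "norm (A (B f) x - c) \<le> \<epsilon> / 2"
      unfolding averaging_commute[OF A(1) B(1)] by (rule averaging_near[OF B(1) A(2)])
    have 2: "norm (A (B h) x - d) \<le> \<epsilon> / 2" by (rule averaging_near[OF A(1) B(2)])
    have "A (B (\<lambda>x. f x + h x)) x - (c + d) = (A (B f) x - c) + (A (B h) x - d)"
      by (simp add: averaging_add A(1) B(1))
    also have "norm \<dots> \<le> norm (A (B f) x - c) + norm (A (B h) x - d)"
      by (rule norm_triangle_ineq)
    also have "\<dots> \<le> \<epsilon>" using 1 2 by linarith
    finally show ?thesis .
  qed
  with averaging.comp[OF A(1) B(1)]
  show "\<exists>A. averaging A \<and> (\<forall>x. norm (A (\<lambda>x. f x + h x) x - (c + d)) \<le> \<epsilon>)" by blast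
qed

lemma has_mean_scale:
  assumes "has_mean f c"
  shows "has_mean (\<lambda>x. a * f x) (a * c)"
  unfolding has_mean_def
proof (intro allI impI)
  fix \<epsilon> :: real assume "\<epsilon> > 0"
  then have "\<epsilon> / (norm a + 1) > 0" by (simp add: add_nonneg_pos)
  then obtain A where A: "averaging A" "\<And>x. norm (A f x - c) \<le> \<epsilon> / (norm a + 1)"
    using assms unfolding has_mean_def by blast
  have "norm (A (\<lambda>x. a * f x) x - a * c) \<le> \<epsilon>" for x
  proof -
    have "norm (A (\<lambda>x. a * f x) x - a * c) = norm a * norm (A f x - c)"
      by (simp add: averaging_scale[OF A(1)] flip: right_diff_distrib norm_mult)
    also have "\<dots> \<le> (norm a + 1) * (\<epsilon> / (norm a + 1))"
      by (intro mult_mono A(2)) auto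
    also have "\<dots> = \<epsilon>"
      by (smt (verit) norm_ge_zero nonzero_mult_div_cancel_left times_divide_eq_right)
    finally show ?thesis .
  qed
  with A(1) show "\<exists>A. averaging A \<and> (\<forall>x. norm (A (\<lambda>x. a * f x) x - a * c) \<le> \<epsilon>)" by blast
qed

lemma has_mean_const: "has_mean (\<lambda>_::'g::ab_group_add. c) c"
  unfolding has_mean_def
proof (intro allI impI)
  fix \<epsilon> :: real assume "\<epsilon> > 0"
  moreover have "averaging (\<lambda>f x::'g. f (x + 0))" by (rule averaging.shift)
  ultimately show "\<exists>A. averaging A \<and> (\<forall>x::'g. norm (A (\<lambda>_. c) x - c) \<le> \<epsilon>)"
    by (intro exI[of _ "\<lambda>f x. f (x + 0)"]) auto
qed

lemma has_mean_shift: "has_mean f c \<Longrightarrow> has_mean (\<lambda>x. f (x + g)) c"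
  unfolding has_mean_def using averaging_shift by metis

lemma has_mean_norm_le:
  assumes "has_mean f c" "\<And>x. norm (f x) \<le> B"
  shows "norm c \<le> B"
proof (rule field_le_epsilon)
  fix \<epsilon> :: real assume "\<epsilon> > 0"
  then obtain A where A: "averaging A" "norm (A f 0 - c) \<le> \<epsilon>"
    using assms(1) unfolding has_mean_def by blast
  have "norm (A f 0) \<le> B" by (rule averaging_norm_le[OF A(1) assms(2)])
  with A(2) norm_triangle_ineq4[of "A f 0" "A f 0 - c"] show "norm c \<le> B + \<epsilon>" by simp
qed

text \<open>
  The bound in the last axiom replaces positivity; together with the normalisation it implies it.
\<close>

locale invariant_mean =
  fixes L :: "('g::topological_ab_group_add \<Rightarrow> complex) \<Rightarrow> complex"
  assumes add: "continuous_on UNIV f \<Longrightarrow> continuous_on UNIV h \<Longrightarrow> L (\<lambda>x. f x + h x) = L f + L h"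
    and scale: "continuous_on UNIV f \<Longrightarrow> L (\<lambda>x. c * f x) = c * L f"
    and const: "L (\<lambda>_. 1) = 1"
    and shift: "continuous_on UNIV f \<Longrightarrow> L (\<lambda>x. f (x + g)) = L f"
    and norm_le: "continuous_on UNIV f \<Longrightarrow> (\<And>x. norm (f x) \<le> B) \<Longrightarrow> norm (L f) \<le> B"

lemma invariant_mean_mean:
  assumes K: "compact (UNIV :: 'g::topological_ab_group_add set)"
  shows "invariant_mean (mean :: ('g \<Rightarrow> complex) \<Rightarrow> complex)"
proof
  fix f h :: "'g \<Rightarrow> complex" and c g B
  assume f: "continuous_on UNIV f"
  note m = has_mean_mean[OF K f]
  show "mean (\<lambda>x. c * f x) = c * mean f" by (rule has_mean_imp_mean[OF has_mean_scale[OF m]])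
  show "mean (\<lambda>x. f (x + g)) = mean f" by (rule has_mean_imp_mean[OF has_mean_shift[OF m]])
  show "norm (mean f) \<le> B" if "\<And>x. norm (f x) \<le> B"
    using has_mean_norm_le[OF m] that by blast
  show "mean (\<lambda>x. f x + h x) = mean f + mean h" if "continuous_on UNIV h"
    by (rule has_mean_imp_mean[OF has_mean_add[OF m has_mean_mean[OF K that]]])
qed (rule has_mean_imp_mean[OF has_mean_const])

lemma invariant_mean_averaging:
  assumes "averaging A" "invariant_mean L" "continuous_on UNIV f"
  shows "L (A f) = L f"
  using assms
proof (induction arbitrary: f rule: averaging.induct)
  case (shift g)
  then show ?case by (intro invariant_mean.shift)
next
  case (mix A B t)
  have c: "continuous_on UNIV (A f)" "continuous_on UNIV (B f)"
    using mix averaging_continuous by blast+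
  have "L (\<lambda>x. of_real t * A f x + of_real (1 - t) * B f x) =
      of_real t * L (A f) + of_real (1 - t) * L (B f)"
    unfolding invariant_mean.add[OF mix.prems(1) continuous_on_mult_left[OF c(1)] continuous_on_mult_left[OF c(2)]]
      invariant_mean.scale[OF mix.prems(1) c(1)] invariant_mean.scale[OF mix.prems(1) c(2)] ..
  also have "\<dots> = L f" using mix by (simp add: algebra_simps)
  finally show ?case .
next
  case (comp A B)
  then show ?case using averaging_continuous[of B f] by metis
qed

text \<open>
  An invariant mean does not see averaging, and some average of \<open>f\<close> is uniformly close to the
  constant \<open>mean f\<close>. Symmetries of the mean and the exchange of iterated means are consequences:
  both sides are invariant means.
\<close>

lemma invariant_mean_unique:
  fixes f :: "'g::topological_ab_group_add \<Rightarrow> complex"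
  assumes K: "compact (UNIV :: 'g set)" and L: "invariant_mean L" and f: "continuous_on UNIV f"
  shows "L f = mean f"
proof -
  have *: "norm (L f - mean f) \<le> \<epsilon>" if "\<epsilon> > 0" for \<epsilon>
  proof -
    obtain A where A: "averaging A" "\<And>x. norm (A f x - mean f) \<le> \<epsilon>"
      using has_mean_mean[OF K f] \<open>\<epsilon> > 0\<close> unfolding has_mean_def by blast
    have c: "continuous_on UNIV (A f)" by (rule averaging_continuous[OF A(1) f])
    have "L (\<lambda>x. A f x + (- mean f) * 1) = L (A f) + L (\<lambda>x. (- mean f) * 1)"
      by (rule invariant_mean.add[OF L c]) (rule continuous_on_const)
    also have "L (\<lambda>x. (- mean f) * 1) = - mean f * L (\<lambda>x. 1)"
      by (rule invariant_mean.scale[OF L continuous_on_const])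
    also have "L (\<lambda>x. 1) = 1" by (rule invariant_mean.const[OF L])
    also have "L (A f) = L f" by (rule invariant_mean_averaging[OF A(1) L f])
    finally have e: "L (\<lambda>x. A f x - mean f) = L f - mean f" by simp
    have "continuous_on UNIV (\<lambda>x. A f x - mean f)" by (intro continuous_intros c)
    from invariant_mean.norm_le[OF L this A(2)] show ?thesis unfolding e .
  qed
  have "norm (L f - mean f) \<le> 0"
    by (rule field_le_epsilon) (simp only: add_0 *)
  then show ?thesis by simp
qed

context
  assumes K: "compact (UNIV :: 'g::topological_ab_group_add set)"
begin

lemmas mean_add = invariant_mean.add[OF invariant_mean_mean[OF K]]
  and mean_scale = invariant_mean.scale[OF invariant_mean_mean[OF K]]
  and mean_shift = invariant_mean.shift[OF invariant_mean_mean[OF K]]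
  and mean_norm_le = invariant_mean.norm_le[OF invariant_mean_mean[OF K]]

lemma mean_const: "mean (\<lambda>_::'g. c) = c"
  by (rule has_mean_imp_mean[OF has_mean_const])

lemma mean_diff:
  "continuous_on UNIV f \<Longrightarrow> continuous_on UNIV h \<Longrightarrow> mean (\<lambda>x::'g. f x - h x) = mean f - mean h"
  using mean_add[of f "\<lambda>x. (-1) * h x"] mean_scale[of h "-1"]
  by (simp add: continuous_on_minus)

lemma mean_uminus:
  assumes f: "continuous_on UNIV f"
  shows "mean (\<lambda>x::'g. f (- x)) = mean f"
proof (rule invariant_mean_unique[OF K _ f, of "\<lambda>f. mean (\<lambda>x. f (- x))"])
  have c: "continuous_on UNIV (\<lambda>x::'g. h (- x) :: complex)" if "continuous_on UNIV h" for h
    by (rule continuous_on_compose2[OF that]) (auto intro!: continuous_intros)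
  have "mean (\<lambda>x. h (- (x + g))) = mean (\<lambda>x. h (- x))" if "continuous_on UNIV h" for h and g :: 'g
    using mean_shift[OF c[OF that], of "g"] .
  from this[of _ "- g" for g]
  have "mean (\<lambda>x. h (- x + g)) = mean (\<lambda>x. h (- x))" if "continuous_on UNIV h" for h and g :: 'g
    using that by (simp only: minus_add_distrib minus_minus)
  then show "invariant_mean (\<lambda>f. mean (\<lambda>x::'g. f (- x)))"
    by unfold_locales (simp_all only: c mean_add mean_scale mean_const mean_norm_le)
qed

lemma mean_reflect:
  assumes f: "continuous_on UNIV f"
  shows "mean (\<lambda>x::'g. f (g - x)) = mean f"
proof -
  have "continuous_on UNIV (\<lambda>x. f (- x))"
    by (rule continuous_on_compose2[OF f]) (auto intro!: continuous_intros)
  from mean_shift[OF this, of "- g"] show ?thesis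
    by (simp add: mean_uminus[OF f])
qed

lemma mean_cnj:
  assumes f: "continuous_on UNIV f"
  shows "mean (\<lambda>x::'g. cnj (f x)) = cnj (mean f)"
proof -
  have c: "continuous_on UNIV (\<lambda>x::'g. cnj (h x))" if "continuous_on UNIV h" for h
    using that by (rule continuous_on_cnj)
  have "invariant_mean (\<lambda>f. cnj (mean (\<lambda>x::'g. cnj (f x))))"
  proof
    fix h :: "'g \<Rightarrow> complex" and g assume h: "continuous_on UNIV h"
    show "cnj (mean (\<lambda>x. cnj (h (x + g)))) = cnj (mean (\<lambda>x. cnj (h x)))"
      by (simp only: mean_shift[OF c[OF h]])
  qed (simp_all add: c mean_add mean_scale mean_const mean_norm_le)
  from invariant_mean_unique[OF K this f] show ?thesis by (metis complex_cnj_cnj)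
qed

text \<open>
  A function with values in \<open>[0, B]\<close> is within \<open>B / 2\<close> of the constant \<open>B / 2\<close>, and so is its
  mean.
\<close>

lemma mean_Re_nonneg:
  assumes f: "continuous_on UNIV f" and nonneg: "\<And>x::'g. f x \<in> \<real>" "\<And>x. Re (f x) \<ge> 0"
  shows "Re (mean f) \<ge> 0"
proof -
  obtain B where B: "B > 0" "\<And>x. norm (f x) \<le> B"
    using bounded_continuous_compact[OF K f] by metis
  have "norm (f x - of_real (B / 2)) \<le> B / 2" for x
  proof -
    obtain r where "f x = of_real r" using nonneg(1) by (auto elim: Reals_cases)
    moreover have "\<bar>r\<bar> \<le> B" "r \<ge> 0" using B(2)[of x] nonneg(2)[of x] calculation by simp_all
    then have "\<bar>r - B / 2\<bar> \<le> B / 2" by arith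
    ultimately show ?thesis by (simp only: norm_of_real flip: of_real_diff)
  qed
  then have "norm (mean (\<lambda>x. f x - of_real (B / 2))) \<le> B / 2"
    by (intro mean_norm_le continuous_intros f)
  then have "norm (mean f - of_real (B / 2)) \<le> B / 2"
    by (simp add: mean_diff[OF f] mean_const)
  then show ?thesis
    using abs_Re_le_cmod[of "mean f - of_real (B / 2)"] by (simp add: abs_le_iff)
qed

text \<open>
  Finitely many translates of the open set where \<open>f\<close> is large cover the group, so that an average
  of \<open>f\<close> is bounded below by a positive constant.
\<close>

lemma mean_Re_pos:
  assumes f: "continuous_on UNIV f" and nonneg: "\<And>x::'g. f x \<in> \<real>" "\<And>x. Re (f x) \<ge> 0"
    and x0: "f x0 \<noteq> 0"
  shows "Re (mean f) > 0"
proof -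
  define c where "c = Re (f x0) / 2"
  have c: "c > 0"
    using x0 nonneg[of x0] by (auto simp: c_def complex_is_Real_iff complex_eq_iff less_le)
  have "open ((\<lambda>x. Re (f x)) -` {c<..})"
    by (rule open_vimage) (auto intro!: continuous_intros f)
  moreover have "x0 \<in> (\<lambda>x. Re (f x)) -` {c<..}" using c by (simp add: c_def)
  ultimately obtain F where F: "finite F" "F \<noteq> {}" "\<And>x. \<exists>g\<in>F. x + g \<in> (\<lambda>x. Re (f x)) -` {c<..}"
    using finitely_many_translates_cover[OF K] by metis
  define n where "n = real (card F)"
  have n: "n > 0" using F by (simp add: n_def card_gt_0_iff)
  define A where "A = (\<lambda>(f :: 'g \<Rightarrow> complex) x. (\<Sum>g\<in>F. f (x + g)) / of_nat (card F))"
  have A: "averaging A" unfolding A_def by (rule averaging_translates[OF F(1,2)])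
  have cA: "continuous_on UNIV (A f)" by (rule averaging_continuous[OF A f])
  have "Re (A f x - of_real (c / n)) \<ge> 0" for x
  proof -
    obtain g where g: "g \<in> F" "Re (f (x + g)) > c" using F(3)[of x] by auto
    have "Re (f (x + g)) \<le> (\<Sum>g\<in>F. Re (f (x + g)))"
      by (rule member_le_sum) (use F g nonneg in auto)
    then have "c / n \<le> (\<Sum>g\<in>F. Re (f (x + g))) / n" using g n by (intro divide_right_mono) auto
    then show ?thesis by (simp add: A_def n_def)
  qed
  moreover have "A f x - of_real (c / n) \<in> \<real>" for x
    unfolding A_def by (intro Reals_diff Reals_divide sum_in_Reals nonneg) auto
  moreover have "continuous_on UNIV (\<lambda>x. A f x - of_real (c / n))" by (intro continuous_intros cA)
  ultimately have "Re (mean (\<lambda>x. A f x - of_real (c / n))) \<ge> 0"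
    by (intro mean_Re_nonneg)
  moreover have "mean (\<lambda>x. A f x - of_real (c / n)) = mean f - of_real (c / n)"
    using invariant_mean_averaging[OF A invariant_mean_mean[OF K] f]
    by (simp add: mean_diff[OF cA] mean_const)
  ultimately show ?thesis using c n by (smt (verit) Re_complex_of_real divide_pos_pos minus_complex.simps(1))
qed

lemma continuous_on_mean:
  fixes F :: "'b::topological_space \<Rightarrow> 'g \<Rightarrow> complex"
  assumes F: "continuous_on UNIV (\<lambda>(x, y). F x y)"
  shows "continuous_on UNIV (\<lambda>x. mean (F x))"
proof -
  have cF: "continuous_on UNIV (F x)" for x
    by (rule continuous_on_compose2[OF F, of UNIV "\<lambda>y. (x, y)", simplified])
      (auto intro!: continuous_intros)
  show ?thesis
    unfolding continuous_on_def
  proof (intro ballI tendstoI)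
    fix x and \<epsilon> :: real assume "\<epsilon> > 0"
    then have \<epsilon>: "\<epsilon> / 2 > 0" by simp
    have "continuous_on (UNIV \<times> UNIV) (\<lambda>(x, y). F x y)" using F by simp
    from continuous_on_prod_compactE[OF this K UNIV_I \<epsilon>, of x]
    obtain X where X: "x \<in> X" "open X" "\<And>x' y. x' \<in> X \<Longrightarrow> dist (F x' y) (F x y) \<le> \<epsilon> / 2"
      by (metis IntI UNIV_I case_prod_conv)
    have "dist (mean (F x')) (mean (F x)) < \<epsilon>" if "x' \<in> X" for x'
    proof -
      have "norm (mean (\<lambda>y. F x' y - F x y)) \<le> \<epsilon> / 2"
        using X(3)[OF that] by (intro mean_norm_le continuous_intros cF) (simp add: dist_norm)
      then show ?thesis using \<open>\<epsilon> > 0\<close> by (simp add: mean_diff cF dist_norm)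
    qed
    then show "\<forall>\<^sub>F x' in at x. dist (mean (F x')) (mean (F x)) < \<epsilon>"
      unfolding eventually_at_topological using X by blast
  qed
qed

end

text \<open>
  The exchange of iterated means is a statement about the mean on \<open>G \<times> G\<close>, which therefore has to
  be a topological group.
\<close>

instance prod :: (topological_monoid_add, topological_monoid_add) topological_monoid_add
proof
  fix a b :: "'a \<times> 'b"
  have "((\<lambda>x. (fst (fst x) + fst (snd x), snd (fst x) + snd (snd x))) \<longlongrightarrow> (fst a + fst b, snd a + snd b))
      (nhds (a, b))"
    using filterlim_ident[of "nhds (a, b)"]
    by (intro tendsto_intros) (auto dest: tendsto_fst tendsto_snd)
  then show "LIM x nhds a \<times>\<^sub>F nhds b. fst x + snd x :> nhds (a + b)"
    by (simp add: nhds_prod plus_prod_def)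
qed

instance prod :: (topological_comm_monoid_add, topological_comm_monoid_add) topological_comm_monoid_add ..

instance prod :: (topological_group_add, topological_group_add) topological_group_add
proof
  fix a :: "'a \<times> 'b"
  have "((\<lambda>x. (- fst x, - snd x)) \<longlongrightarrow> (- fst a, - snd a)) (nhds a)"
    using filterlim_ident[of "nhds a"]
    by (intro tendsto_intros) (auto dest: tendsto_fst tendsto_snd)
  then show "(uminus \<longlongrightarrow> - a) (nhds a)"
    by (simp add: uminus_prod_def[abs_def])
qed

instance prod :: (topological_ab_group_add, topological_ab_group_add) topological_ab_group_add ..

lemma invariant_mean_iterated:
  assumes K: "compact (UNIV :: 'g::topological_ab_group_add set)"
  shows "invariant_mean (\<lambda>F :: 'g \<times> 'g \<Rightarrow> complex. mean (\<lambda>x. mean (\<lambda>y. F (x, y))))"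
proof -
  have c1: "continuous_on UNIV (\<lambda>y. F (x, y))" if "continuous_on UNIV F" for F :: "'g \<times> 'g \<Rightarrow> complex" and x
    by (rule continuous_on_compose2[OF that]) (auto intro!: continuous_intros)
  have c2: "continuous_on UNIV (\<lambda>x. mean (\<lambda>y. F (x, y)))" if "continuous_on UNIV F" for F :: "'g \<times> 'g \<Rightarrow> complex"
    using that by (intro continuous_on_mean[OF K]) simp
  have sh: "mean (\<lambda>x. mean (\<lambda>y. F (x + a, y + b))) = mean (\<lambda>x. mean (\<lambda>y. F (x, y)))"
    if "continuous_on UNIV F" for F :: "'g \<times> 'g \<Rightarrow> complex" and a b
    using mean_shift[OF K c1[OF that], of _ b] mean_shift[OF K c2[OF that], of a] by simp
  show ?thesis
    by unfold_locales
      (simp_all add: c1 c2 sh mean_add[OF K] mean_scale[OF K] mean_const[OF K] mean_norm_le[OF K]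
        del: add_Pair add: plus_prod_def split_beta)
qed

text \<open>
  Both iterated means are invariant means on \<open>G \<times> G\<close>, the second one after swapping the factors.
\<close>

lemma mean_swap:
  fixes F :: "'g::topological_ab_group_add \<Rightarrow> 'g \<Rightarrow> complex"
  assumes K: "compact (UNIV :: 'g set)" and F: "continuous_on UNIV (\<lambda>(x, y). F x y)"
  shows "mean (\<lambda>x. mean (\<lambda>y. F x y)) = mean (\<lambda>y. mean (\<lambda>x. F x y))"
proof -
  have KK: "compact (UNIV :: ('g \<times> 'g) set)"
    using compact_Times[OF K K] by simp
  have F': "continuous_on UNIV (\<lambda>(y, x). F x y)"
    using continuous_on_compose2[OF F continuous_on_swap, of UNIV] by (simp add: split_beta)
  have sw: "mean (\<lambda>z::'g \<times> 'g. f (snd z, fst z)) = mean f"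
    if f: "continuous_on UNIV f" for f :: "'g \<times> 'g \<Rightarrow> complex"
  proof (rule invariant_mean_unique[OF KK _ f, of "\<lambda>f. mean (\<lambda>z. f (snd z, fst z))"])
    have c: "continuous_on UNIV (\<lambda>z. h (snd z, fst z))" if "continuous_on UNIV h" for h :: "'g \<times> 'g \<Rightarrow> complex"
      by (rule continuous_on_compose2[OF that]) (auto intro!: continuous_intros)
    have "mean (\<lambda>z. h (snd z + a, fst z + b)) = mean (\<lambda>z. h (snd z, fst z))"
      if "continuous_on UNIV h" for h :: "'g \<times> 'g \<Rightarrow> complex" and a b
      using mean_shift[OF KK c[OF that], of "(b, a)"] by simp
    then show "invariant_mean (\<lambda>f. mean (\<lambda>z::'g \<times> 'g. f (snd z, fst z)))"
      by unfold_locales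
        (simp_all add: c mean_add[OF KK] mean_scale[OF KK] mean_const[OF KK] mean_norm_le[OF KK]
          plus_prod_def)
  qed
  show ?thesis
    using invariant_mean_unique[OF KK invariant_mean_iterated[OF K] F]
      invariant_mean_unique[OF KK invariant_mean_iterated[OF K] F'] sw[OF F]
    by (simp add: case_prod_unfold)
qed


section \<open>Convolution\<close>

definition conv :: "('g::ab_group_add \<Rightarrow> complex) \<Rightarrow> ('g \<Rightarrow> complex) \<Rightarrow> 'g \<Rightarrow> complex" where
  "conv f h x = mean (\<lambda>y. f y * h (x - y))"

definition sqnorm :: "('g::ab_group_add \<Rightarrow> complex) \<Rightarrow> real" where
  "sqnorm f = Re (mean (\<lambda>x. f x * cnj (f x)))"

text \<open>
  The self-adjoint elements for the involution \<open>f\<^sup>* x = cnj (f (- x))\<close> of the convolution algebra.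
\<close>

definition hermitian :: "('g::ab_group_add \<Rightarrow> complex) \<Rightarrow> bool" where
  "hermitian f \<longleftrightarrow> (\<forall>x. f (- x) = cnj (f x))"

lemma hermitianD: "hermitian f \<Longrightarrow> f (- x) = cnj (f x)"
  by (simp add: hermitian_def)

lemma continuous_UNIV_compose:
  "continuous_on UNIV f \<Longrightarrow> continuous_on S g \<Longrightarrow> continuous_on S (\<lambda>x. f (g x))"
  by (rule continuous_on_compose2) auto

lemma conv_shift_right:
  fixes f h :: "'g::ab_group_add \<Rightarrow> complex"
  shows "conv f (\<lambda>x. h (x + g)) = (\<lambda>x. conv f h (x + g))"
  unfolding conv_def by (simp add: algebra_simps)

lemma conv_hermitian_zero:
  fixes f h :: "'g::ab_group_add \<Rightarrow> complex"
  assumes "hermitian h"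
  shows "conv f h 0 = mean (\<lambda>y. f y * cnj (h y))"
  by (simp add: conv_def hermitianD[OF assms])

context
  assumes K: "compact (UNIV :: 'g::topological_ab_group_add set)"
begin

lemma mean_mult_cnj:
  fixes f :: "'g \<Rightarrow> complex"
  assumes f: "continuous_on UNIV f"
  shows "mean (\<lambda>x. f x * cnj (f x)) = of_real (sqnorm f)"
    and "sqnorm f \<ge> 0"
    and "f x0 \<noteq> 0 \<Longrightarrow> sqnorm f > 0"
proof -
  have c: "continuous_on UNIV (\<lambda>x. f x * cnj (f x))"
    by (intro continuous_intros f)
  have r: "f x * cnj (f x) \<in> \<real>" "Re (f x * cnj (f x)) \<ge> 0" for x
    by (simp_all add: complex_mult_cnj)
  have "cnj (mean (\<lambda>x. f x * cnj (f x))) = mean (\<lambda>x. f x * cnj (f x))"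
    using mean_cnj[OF K c] by (simp add: mult.commute)
  then show "mean (\<lambda>x. f x * cnj (f x)) = of_real (sqnorm f)"
    by (simp add: sqnorm_def complex_eq_iff)
  show "sqnorm f \<ge> 0"
    unfolding sqnorm_def by (rule mean_Re_nonneg[OF K c r])
  show "sqnorm f > 0" if "f x0 \<noteq> 0"
    unfolding sqnorm_def by (rule mean_Re_pos[OF K c r, of x0]) (use that in simp)
qed

lemma mean_Cauchy_Schwarz:
  fixes f h :: "'g \<Rightarrow> complex"
  assumes f: "continuous_on UNIV f" and h: "continuous_on UNIV h"
  shows "(norm (mean (\<lambda>x. f x * cnj (h x))))\<^sup>2 \<le> sqnorm f * sqnorm h"
proof (cases "\<exists>x. h x \<noteq> 0")
  case False
  then show ?thesis by (simp add: mean_const[OF K] sqnorm_def)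
next
  case True
  then have N: "sqnorm h > 0" using mean_mult_cnj(3)[OF h] by blast
  define c where "c = mean (\<lambda>x. f x * cnj (h x))"
  define a where "a = c / of_real (sqnorm h)"
  have c': "mean (\<lambda>x. h x * cnj (f x)) = cnj c"
    using mean_cnj[OF K, of "\<lambda>x. f x * cnj (h x)"] f h
    by (simp add: c_def continuous_intros mult.commute)
  have cd: "continuous_on UNIV (\<lambda>x. f x - a * h x)" by (intro continuous_intros f h)
  have "of_real (sqnorm (\<lambda>x. f x - a * h x)) =
      mean (\<lambda>x. (f x - a * h x) * cnj (f x - a * h x))"
    by (rule mean_mult_cnj(1)[OF cd, symmetric])
  also have "(\<lambda>x. (f x - a * h x) * cnj (f x - a * h x)) =
      (\<lambda>x. (f x * cnj (f x) - cnj a * (f x * cnj (h x))) -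
        (a * (h x * cnj (f x)) - (a * cnj a) * (h x * cnj (h x))))"
    by (rule ext) (simp add: algebra_simps)
  also have "mean \<dots> = (of_real (sqnorm f) - cnj a * c) -
      (a * cnj c - (a * cnj a) * of_real (sqnorm h))"
    by (simp add: mean_diff[OF K] mean_scale[OF K] continuous_intros f h c' mean_mult_cnj(1) flip: c_def)
  also have "\<dots> = of_real (sqnorm f - (norm c)\<^sup>2 / sqnorm h)"
    using N by (simp add: a_def complex_norm_square[symmetric] power2_eq_square field_simps)
  finally have "sqnorm f - (norm c)\<^sup>2 / sqnorm h = sqnorm (\<lambda>x. f x - a * h x)"
    by (metis of_real_eq_iff)
  then have "sqnorm f - (norm c)\<^sup>2 / sqnorm h \<ge> 0" using mean_mult_cnj(2)[OF cd] by simp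
  then show ?thesis using N by (simp add: c_def field_simps)
qed

lemma sqnorm_le:
  fixes f :: "'g \<Rightarrow> complex"
  assumes f: "continuous_on UNIV f" and B: "\<And>x. (norm (f x))\<^sup>2 \<le> B"
  shows "sqnorm f \<le> B"
proof -
  have "norm (mean (\<lambda>x. f x * cnj (f x))) \<le> B"
    by (rule mean_norm_le[OF K]) (use B in \<open>auto intro!: continuous_intros f simp: norm_mult power2_eq_square\<close>)
  then show ?thesis
    using complex_Re_le_cmod[of "mean (\<lambda>x. f x * cnj (f x))"] by (simp add: sqnorm_def)
qed

lemma continuous_conv_integrand:
  fixes f h :: "'g \<Rightarrow> complex"
  assumes "continuous_on UNIV f" "continuous_on UNIV h"
  shows "continuous_on UNIV (\<lambda>y. f y * h (x - y))"
  by (intro continuous_on_mult assms continuous_UNIV_compose[OF assms(2)] continuous_intros)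

lemma continuous_conv:
  fixes f h :: "'g \<Rightarrow> complex"
  assumes f: "continuous_on UNIV f" and h: "continuous_on UNIV h"
  shows "continuous_on UNIV (conv f h)"
  unfolding conv_def[abs_def]
  by (rule continuous_on_mean[OF K], unfold case_prod_unfold,
      intro continuous_on_mult continuous_UNIV_compose[OF f] continuous_UNIV_compose[OF h] continuous_intros)

lemma conv_commute:
  fixes f h :: "'g \<Rightarrow> complex"
  assumes f: "continuous_on UNIV f" and h: "continuous_on UNIV h"
  shows "conv f h = conv h f"
proof
  fix x show "conv f h x = conv h f x"
    using mean_reflect[OF K continuous_conv_integrand[OF f h], of x x]
    by (simp add: conv_def mult.commute)
qed

lemma conv_assoc:
  fixes e f h :: "'g \<Rightarrow> complex"
  assumes e: "continuous_on UNIV e" and f: "continuous_on UNIV f" and h: "continuous_on UNIV h"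
  shows "conv (conv e f) h = conv e (conv f h)"
proof
  fix x
  have "conv (conv e f) h x = mean (\<lambda>y. mean (\<lambda>z. h (x - y) * (e z * f (y - z))))"
    by (simp add: conv_def mean_scale[OF K continuous_conv_integrand[OF e f]] mult.commute)
  also have "\<dots> = mean (\<lambda>z. mean (\<lambda>y. h (x - y) * (e z * f (y - z))))"
    by (rule mean_swap[OF K], unfold case_prod_unfold,
      intro continuous_on_mult continuous_UNIV_compose[OF e] continuous_UNIV_compose[OF f]
        continuous_UNIV_compose[OF h] continuous_intros)
  also have "\<dots> = mean (\<lambda>z. e z * mean (\<lambda>y. f y * h (x - z - y)))"
  proof (rule arg_cong[of _ _ mean], rule ext)
    fix z
    have c: "continuous_on UNIV (\<lambda>y. f y * h (x - z - y))"
      by (rule continuous_conv_integrand[OF f h])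
    have "mean (\<lambda>y. f (y + (- z)) * h (x - z - (y + (- z)))) = mean (\<lambda>y. f y * h (x - z - y))"
      by (rule mean_shift[OF K c])
    moreover have "continuous_on UNIV (\<lambda>y. f (y + (- z)) * h (x - z - (y + (- z))))"
      by (rule continuous_UNIV_compose[OF c]) (intro continuous_intros)
    ultimately have "mean (\<lambda>y. e z * (f (y + (- z)) * h (x - z - (y + (- z))))) =
        e z * mean (\<lambda>y. f y * h (x - z - y))"
      using mean_scale[OF K] by metis
    then show "mean (\<lambda>y. h (x - y) * (e z * f (y - z))) = e z * mean (\<lambda>y. f y * h (x - z - y))"
      by (simp add: ac_simps)
  qed
  finally show "conv (conv e f) h x = conv e (conv f h) x" by (simp add: conv_def)
qed

lemma conv_add_left:
  fixes e f h :: "'g \<Rightarrow> complex"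
  assumes "continuous_on UNIV e" "continuous_on UNIV f" "continuous_on UNIV h"
  shows "conv (\<lambda>x. e x + f x) h = (\<lambda>x. conv e h x + conv f h x)"
  unfolding conv_def
  by (simp add: distrib_right mean_add[OF K continuous_conv_integrand continuous_conv_integrand] assms)

lemma conv_diff_left:
  fixes e f h :: "'g \<Rightarrow> complex"
  assumes "continuous_on UNIV e" "continuous_on UNIV f" "continuous_on UNIV h"
  shows "conv (\<lambda>x. e x - f x) h = (\<lambda>x. conv e h x - conv f h x)"
  unfolding conv_def
  by (simp add: left_diff_distrib mean_diff[OF K continuous_conv_integrand continuous_conv_integrand] assms)

lemma conv_scale_left:
  fixes f h :: "'g \<Rightarrow> complex"
  assumes "continuous_on UNIV f" "continuous_on UNIV h"
  shows "conv (\<lambda>x. c * f x) h = (\<lambda>x. c * conv f h x)"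
  unfolding conv_def
  by (simp add: mult.assoc mean_scale[OF K continuous_conv_integrand] assms)

lemma conv_add_right:
  fixes e f h :: "'g \<Rightarrow> complex"
  assumes "continuous_on UNIV e" "continuous_on UNIV f" "continuous_on UNIV h"
  shows "conv h (\<lambda>x. e x + f x) = (\<lambda>x. conv h e x + conv h f x)"
  unfolding conv_def
  by (simp add: distrib_left mean_add[OF K continuous_conv_integrand continuous_conv_integrand] assms)

lemma conv_diff_right:
  fixes e f h :: "'g \<Rightarrow> complex"
  assumes "continuous_on UNIV e" "continuous_on UNIV f" "continuous_on UNIV h"
  shows "conv h (\<lambda>x. e x - f x) = (\<lambda>x. conv h e x - conv h f x)"
  unfolding conv_def
  by (simp add: right_diff_distrib mean_diff[OF K continuous_conv_integrand continuous_conv_integrand] assms)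

lemma conv_scale_right:
  fixes f h :: "'g \<Rightarrow> complex"
  assumes "continuous_on UNIV f" "continuous_on UNIV h"
  shows "conv h (\<lambda>x. c * f x) = (\<lambda>x. c * conv h f x)"
  unfolding conv_def
  by (simp add: mult.left_commute[of _ c] mean_scale[OF K continuous_conv_integrand] assms)

text \<open>
  Convolution turns square norms into supremum norms. This gain replaces the compactness of
  convolution operators.
\<close>

lemma conv_norm_le:
  fixes f h :: "'g \<Rightarrow> complex"
  assumes f: "continuous_on UNIV f" and h: "continuous_on UNIV h"
  shows "(norm (conv f h x))\<^sup>2 \<le> sqnorm f * sqnorm h"
proof -
  have c: "continuous_on UNIV (\<lambda>y. cnj (h (x - y)))"
    by (intro continuous_intros continuous_UNIV_compose[OF h])
  have "sqnorm (\<lambda>y. cnj (h (x - y))) = sqnorm h"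
    using mean_reflect[OF K, of "\<lambda>y. h y * cnj (h y)" x] h
    by (simp add: sqnorm_def continuous_intros mult.commute)
  then show ?thesis using mean_Cauchy_Schwarz[OF f c] by (simp add: conv_def)
qed

lemma conv_norm_le_sup:
  fixes f h :: "'g \<Rightarrow> complex"
  assumes f: "continuous_on UNIV f" and h: "continuous_on UNIV h"
    and "\<And>x. norm (f x) \<le> B" "\<And>x. norm (h x) \<le> C"
  shows "norm (conv f h x) \<le> B * C"
  unfolding conv_def
proof (rule mean_norm_le[OF K continuous_conv_integrand[OF f h]])
  fix y
  have "0 \<le> B" using assms(3) norm_ge_zero order_trans by blast
  then show "norm (f y * h (x - y)) \<le> B * C"
    unfolding norm_mult by (intro mult_mono assms) auto
qed

lemma hermitian_conv:
  fixes f h :: "'g \<Rightarrow> complex"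
  assumes f: "continuous_on UNIV f" and h: "continuous_on UNIV h" and "hermitian f" "hermitian h"
  shows "hermitian (conv f h)"
  unfolding hermitian_def
proof
  fix x
  have "conv f h (- x) = mean (\<lambda>y. f (- y) * h (- x - - y))"
    unfolding conv_def by (rule mean_uminus[OF K continuous_conv_integrand[OF f h], symmetric])
  also have "\<dots> = mean (\<lambda>y. cnj (f y * h (x - y)))"
    using hermitianD[OF assms(3)] hermitianD[OF assms(4), of "x - y" for y] by simp
  also have "\<dots> = cnj (conv f h x)"
    unfolding conv_def by (rule mean_cnj[OF K continuous_conv_integrand[OF f h]])
  finally show "conv f h (- x) = cnj (conv f h x)" .
qed

lemma conv_self_zero:
  fixes f :: "'g \<Rightarrow> complex"
  assumes "continuous_on UNIV f" "hermitian f"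
  shows "conv f f 0 = of_real (sqnorm f)"
  by (simp add: conv_hermitian_zero assms mean_mult_cnj(1))

end


section \<open>Characters from idempotents\<close>

text \<open>
  By log-convexity the quotients \<open>a (n + 1) / a n\<close> increase to a limit \<open>l\<close>, so that
  \<open>a n / l ^ (n + 1)\<close> decreases. By submultiplicativity the limit cannot be \<open>0\<close>:
  for every \<open>k\<close>, \<open>a n \<ge> a (k + n + 1) / a k\<close>, which is a product of \<open>n + 1\<close>
  quotients and tends to \<open>l ^ (n + 1)\<close> as \<open>k\<close> grows. The exponent is shifted because
  \<open>a n\<close> will belong to the \<open>(n + 1)\<close>-st power of a function.
\<close>

lemma log_convex_growth:
  fixes a :: "nat \<Rightarrow> real"
  assumes pos: "\<And>n. a n > 0"
    and log_convex: "\<And>n. (a (Suc n))\<^sup>2 \<le> a n * a (Suc (Suc n))"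
    and submult: "\<And>m n. a (Suc (m + n)) \<le> a m * a n"
  obtains l L where "l > 0" "L \<ge> 1" "(\<lambda>n. a n / l ^ Suc n) \<longlonglongrightarrow> L"
proof -
  define r where "r n = a (Suc n) / a n" for n
  have r_pos: "r n > 0" for n by (simp add: r_def pos)
  have a_Suc: "a (Suc n) = r n * a n" for n using pos[of n] by (simp add: r_def)
  have "incseq r"
    using pos log_convex by (intro incseq_SucI) (simp add: r_def field_simps power2_eq_square)
  moreover have "r n \<le> a 0" for n
    using submult[of n 0] pos[of n] by (simp add: r_def field_simps)
  ultimately obtain l where l: "r \<longlonglongrightarrow> l" "\<And>n. r n \<le> l"
    by (metis incseq_convergent)
  have l_pos: "l > 0" using r_pos[of 0] l(2)[of 0] by linarith
  have lower: "l ^ Suc n \<le> a n" for n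
  proof (rule LIMSEQ_le_const2)
    show "(\<lambda>k. r k ^ Suc n) \<longlonglongrightarrow> l ^ Suc n" by (intro tendsto_power l)
    have "r k ^ Suc n \<le> a n" for k
    proof -
      have "r k ^ j * a k \<le> a (k + j)" for j
      proof (induction j)
        case (Suc j)
        have "r k ^ Suc j * a k \<le> r k * a (k + j)"
          using mult_left_mono[OF Suc, of "r k"] r_pos[of k] by (simp add: mult.assoc)
        also have "\<dots> \<le> r (k + j) * a (k + j)"
          using pos[of "k + j"] \<open>incseq r\<close> by (intro mult_right_mono) (auto simp: incseq_def)
        finally show ?case by (simp add: a_Suc)
      qed simp
      from this[of "Suc n"] have "r k ^ Suc n * a k \<le> a (Suc (k + n))" by simp
      also have "\<dots> \<le> a n * a k" using submult[of k n] by (simp add: mult.commute)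
      finally show ?thesis using pos[of k] by (rule mult_right_le_imp_le)
    qed
    then show "\<exists>N. \<forall>k\<ge>N. r k ^ Suc n \<le> a n" by blast
  qed
  define b where "b n = a n / l ^ Suc n" for n
  have b1: "b n \<ge> 1" for n
    using lower[of n] l_pos by (simp add: b_def)
  have "decseq b"
  proof (rule decseq_SucI)
    fix n
    have "a (Suc n) \<le> l * a n" using l(2)[of n] pos[of n] by (simp add: a_Suc)
    then show "b (Suc n) \<le> b n" using l_pos by (simp add: b_def field_simps)
  qed
  then obtain L where L: "b \<longlonglongrightarrow> L" using decseq_convergent[of b 1] b1 by metis
  moreover from L b1 have "L \<ge> 1" by (intro LIMSEQ_le_const) auto
  ultimately show thesis using that[OF l_pos, of L] unfolding b_def by blast
qed

text \<open>
  These are the kernels of the orthogonal projections onto the nonzero finite-dimensional invariant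
  spaces of functions, and their squared norm is the dimension of that space.
\<close>

definition hermitian_idempotent :: "('g::topological_ab_group_add \<Rightarrow> complex) \<Rightarrow> bool" where
  "hermitian_idempotent p \<longleftrightarrow>
     continuous_on UNIV p \<and> hermitian p \<and> conv p p = p \<and> (\<exists>x. p x \<noteq> 0)"

context
  assumes K: "compact (UNIV :: 'g::topological_ab_group_add set)"
begin

lemma tendsto_conv:
  fixes f p :: "'g \<Rightarrow> complex"
  assumes lim: "uniform_limit UNIV F p sequentially"
    and F: "\<And>n. continuous_on UNIV (F n)" and p: "continuous_on UNIV p" and f: "continuous_on UNIV f"
  shows "(\<lambda>n. conv (F n) f x) \<longlonglongrightarrow> conv p f x"
proof (rule tendstoI)
  fix \<epsilon> :: real assume "\<epsilon> > 0"
  obtain B where B: "B > 0" "\<And>x. norm (f x) \<le> B" using bounded_continuous_compact[OF K f] by metis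
  have "\<epsilon> / (2 * B) > 0" using \<open>\<epsilon> > 0\<close> B by simp
  then have "\<forall>\<^sub>F n in sequentially. \<forall>y\<in>UNIV. dist (F n y) (p y) < \<epsilon> / (2 * B)"
    by (rule uniform_limitD[OF lim])
  then show "\<forall>\<^sub>F n in sequentially. dist (conv (F n) f x) (conv p f x) < \<epsilon>"
  proof eventually_elim
    case (elim n)
    then have "norm (F n y - p y) \<le> \<epsilon> / (2 * B)" for y by (auto simp: dist_norm less_imp_le)
    then have "norm (conv (\<lambda>y. F n y - p y) f x) \<le> \<epsilon> / (2 * B) * B"
      by (intro conv_norm_le_sup[OF K] continuous_on_diff F p f B)
    also have "\<dots> < \<epsilon>" using \<open>\<epsilon> > 0\<close> B by simp
    finally show ?case by (simp add: conv_diff_left[OF K F p f] dist_norm)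
  qed
qed

text \<open>
  Power iteration. The squared norms \<open>a n\<close> of the powers of \<open>v\<close> are log-convex by the
  Cauchy-Schwarz inequality and submultiplicative by \<open>conv_norm_le\<close>. The inner products of the
  even powers are again values of \<open>a\<close>, so that convergence of the scaled sequence \<open>a\<close> makes the
  scaled even powers \<open>W n\<close> a Cauchy sequence in the square norm; one more convolution makes
  it uniform. The algebraic properties of the limit \<open>p\<close> come from
  \<open>W m * W n = W (m + n + 1)\<close>. The last conclusion keeps \<open>p\<close> inside the ideal of an idempotent
  \<open>e\<close> if \<open>v\<close> lies there.
\<close>

lemma spectral_idempotent:
  fixes v :: "'g \<Rightarrow> complex"
  assumes v: "continuous_on UNIV v" and herm: "hermitian v" and nonzero: "v x0 \<noteq> 0"
  obtains p and l :: real where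
    "continuous_on UNIV p" "hermitian p" "conv p p = p" "p 0 \<noteq> 0"
    "l > 0" "conv (conv v v) p = (\<lambda>x. of_real l * p x)"
    "\<And>e. continuous_on UNIV e \<Longrightarrow> conv v e = v \<Longrightarrow> conv p e = p"
proof -
  \<comment> \<open>Convolution need not have a unit, so the powers start at \<open>v\<close> itself: \<open>P n\<close> is the
    \<open>(n + 1)\<close>-st power of \<open>v\<close>, and \<open>W n\<close> below is the \<open>(2 n + 2)\<close>-nd power, scaled.\<close>
  define P where "P n = (conv v ^^ n) v" for n
  have P_0: "P 0 = v" and P_Suc: "P (Suc n) = conv v (P n)" for n by (simp_all add: P_def)
  have P: "continuous_on UNIV (P n)" for n
    by (induction n) (simp_all add: P_0 P_Suc v continuous_conv[OF K])
  have hermP: "hermitian (P n)" for n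
    by (induction n) (simp_all add: P_0 P_Suc herm hermitian_conv[OF K v P])
  have PP: "conv (P m) (P n) = P (Suc (m + n))" for m n
    by (induction m) (simp_all add: P_0 P_Suc conv_assoc[OF K v P P])
  define a where "a n = sqnorm (P n)" for n
  have P_odd: "P (Suc (n + n)) 0 = of_real (a n)" for n
    using conv_self_zero[OF K P hermP] by (simp add: PP a_def)
  have log_convex: "(a (Suc n))\<^sup>2 \<le> a n * a (Suc (Suc n))" for n
    using conv_norm_le[OF K P P, of n "Suc (Suc n)" 0] P_odd[of "Suc n"]
    by (simp add: PP a_def)
  have submult: "a (Suc (m + n)) \<le> a m * a n" for m n
  proof -
    have "sqnorm (conv (P m) (P n)) \<le> a m * a n"
      unfolding a_def by (rule sqnorm_le[OF K continuous_conv[OF K P P] conv_norm_le[OF K P P]])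
    then show ?thesis by (simp add: PP a_def)
  qed
  have "a 0 > 0" using mean_mult_cnj(3)[OF K v nonzero] by (simp add: a_def P_0)
  moreover from this have "a (Suc 0) > 0"
    using mean_mult_cnj(3)[OF K P, of "Suc 0" 0] P_odd[of 0] by (simp add: a_def)
  ultimately have "a n > 0 \<and> a (Suc n) > 0" for n
  proof (induction n)
    case (Suc n)
    then have "0 < a n * a (Suc (Suc n))" using log_convex[of n] by (smt (verit) zero_less_power)
    with Suc show ?case by (simp add: zero_less_mult_iff)
  qed simp
  then have pos: "a n > 0" for n by blast
  obtain l L where l: "l > 0" and L: "L \<ge> 1" "(\<lambda>n. a n / l ^ Suc n) \<longlonglongrightarrow> L"
    using log_convex_growth[OF pos log_convex submult] by metis
  define b where "b n = a n / l ^ Suc n" for n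
  define W where "W n x = of_real (1 / l ^ Suc n) * P (Suc (n + n)) x" for n x
  have W: "continuous_on UNIV (W n)" for n
    unfolding W_def[abs_def] by (intro continuous_on_mult_left P)
  have hermW: "hermitian (W n)" for n
    using hermitianD[OF hermP] by (simp add: hermitian_def W_def)
  have W_0: "W n 0 = of_real (b n)" for n by (simp add: W_def P_odd b_def)
  have WW: "conv (W m) (W n) = W (Suc (m + n))" for m n
  proof -
    have "Suc (Suc (m + m) + Suc (n + n)) = Suc (Suc (m + n) + Suc (m + n))" by simp
    then show ?thesis
      unfolding W_def[abs_def]
      by (simp only: conv_scale_left[OF K P continuous_on_mult_left[OF P]] conv_scale_right[OF K P P] PP)
        (simp add: power_add ac_simps)
  qed
  have sqnorm_W: "sqnorm (\<lambda>x. W n x - W k x) = b (Suc (n + n)) - 2 * b (Suc (n + k)) + b (Suc (k + k))" for n k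
  proof -
    have c: "continuous_on UNIV (\<lambda>x. W n x - W k x)" by (intro continuous_intros W)
    have "hermitian (\<lambda>x. W n x - W k x)" using hermW by (simp add: hermitian_def)
    from conv_self_zero[OF K c this]
    have "of_real (sqnorm (\<lambda>x. W n x - W k x)) =
        (of_real (b (Suc (n + n)) - 2 * b (Suc (n + k)) + b (Suc (k + k))) :: complex)"
      by (simp add: conv_diff_left[OF K W W c] conv_diff_right[OF K W W W] WW W_0 add.commute add_diff_eq)
    then show ?thesis by (simp only: of_real_eq_iff)
  qed
  have "uniformly_Cauchy_on UNIV (\<lambda>n. W (Suc n))"
    unfolding uniformly_Cauchy_on_def
  proof (intro allI impI)
    fix \<epsilon> :: real assume \<epsilon>: "\<epsilon> > 0"
    define s where "s = sqnorm (W 0)"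
    have s: "s \<ge> 0" unfolding s_def by (rule mean_mult_cnj(2)[OF K W])
    define d where "d = \<epsilon>\<^sup>2 / (4 * (s + 1))"
    have d: "d > 0" using \<epsilon> s by (simp add: d_def)
    obtain N where N: "\<And>n. n \<ge> N \<Longrightarrow> \<bar>b n - L\<bar> < d"
      using LIMSEQ_D[OF L(2) d] by (auto simp: b_def)
    have "dist (W (Suc n) x) (W (Suc k) x) < \<epsilon>" if "n \<ge> N" "k \<ge> N" for n k x
    proof -
      have c: "continuous_on UNIV (\<lambda>x. W n x - W k x)" by (intro continuous_intros W)
      have "sqnorm (\<lambda>x. W n x - W k x) \<le> 4 * d"
        using N[of "Suc (n + n)"] N[of "Suc (n + k)"] N[of "Suc (k + k)"] that
        by (simp add: sqnorm_W abs_le_iff abs_less_iff)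
      then have "s * sqnorm (\<lambda>x. W n x - W k x) \<le> s * (4 * d)" using s by (rule mult_left_mono)
      also have "\<dots> < (s + 1) * (4 * d)" using d by simp
      also have "\<dots> = \<epsilon>\<^sup>2"
      proof -
        have "4 * (s + 1) \<noteq> 0" using s by simp
        then show ?thesis
          unfolding d_def by (metis mult.assoc mult.commute nonzero_eq_divide_eq)
      qed
      finally have "(norm (conv (W 0) (\<lambda>x. W n x - W k x) x))\<^sup>2 < \<epsilon>\<^sup>2"
        using conv_norm_le[OF K W c, of 0 x] by (simp add: s_def)
      then have "norm (conv (W 0) (\<lambda>x. W n x - W k x) x) < \<epsilon>"
        using \<epsilon> by (simp add: power2_less_imp_less)
      then show ?thesis by (simp add: conv_diff_right[OF K W W W] WW dist_norm)
    qed
    then show "\<exists>M. \<forall>x\<in>UNIV. \<forall>m\<ge>M. \<forall>n\<ge>M. dist (W (Suc m) x) (W (Suc n) x) < \<epsilon>" by blast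
  qed
  then obtain p where lim: "uniform_limit UNIV (\<lambda>n. W (Suc n)) p sequentially"
    by (metis uniformly_convergent_eq_Cauchy uniformly_convergent_on_def)
  have p: "continuous_on UNIV p"
    by (rule uniform_limit_theorem[OF _ lim]) (simp_all add: W)
  have ptw: "(\<lambda>n. W (Suc n) x) \<longlonglongrightarrow> p x" for x
    by (rule tendsto_uniform_limitI[OF lim]) simp
  note lim_conv = tendsto_conv[OF lim W p]
  have pW: "conv p (W m) = p" for m
  proof
    fix x
    have "(\<lambda>n. W (Suc (n + Suc m)) x) \<longlonglongrightarrow> p x"
      by (rule LIMSEQ_ignore_initial_segment[OF ptw])
    then have "(\<lambda>n. conv (W (Suc n)) (W m) x) \<longlonglongrightarrow> p x" by (simp add: WW)
    with lim_conv[OF W] show "conv p (W m) x = p x" by (rule LIMSEQ_unique)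
  qed
  show thesis
  proof (rule that[OF p _ _ _ l])
    show "conv p p = p"
    proof
      fix x
      have "(\<lambda>n. conv (W (Suc n)) p x) \<longlonglongrightarrow> p x"
        by (simp add: conv_commute[OF K W p] pW)
      with lim_conv[OF p] show "conv p p x = p x" by (rule LIMSEQ_unique)
    qed
    show "hermitian p"
      unfolding hermitian_def
    proof
      fix x
      have "(\<lambda>n. W (Suc n) (- x)) \<longlonglongrightarrow> cnj (p x)"
        using tendsto_cnj[OF ptw[of x]] by (simp add: hermitianD[OF hermW])
      with ptw show "p (- x) = cnj (p x)" by (rule LIMSEQ_unique)
    qed
    have "(\<lambda>n. of_real (b (Suc n)) :: complex) \<longlonglongrightarrow> of_real L"
      using L(2) unfolding b_def[symmetric] by (intro tendsto_of_real LIMSEQ_Suc)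
    with ptw[of 0] have "p 0 = of_real L" unfolding W_0 by (rule LIMSEQ_unique)
    then show "p 0 \<noteq> 0" using L(1) by auto
    have "conv v v = (\<lambda>x. of_real l * W 0 x)"
      using l by (simp add: W_def[abs_def] P_Suc P_0)
    then show "conv (conv v v) p = (\<lambda>x. of_real l * p x)"
      by (simp add: conv_scale_left[OF K W p] conv_commute[OF K W p] pW)
    fix e :: "'g \<Rightarrow> complex" assume e: "continuous_on UNIV e" and ve: "conv v e = v"
    have Pe: "conv (P n) e = P n" for n
      by (induction n) (simp_all add: P_0 P_Suc ve conv_assoc[OF K v P e])
    have "conv (W n) e = W n" for n
      unfolding W_def[abs_def] by (simp only: conv_scale_left[OF K P e] Pe)
    then have "(\<lambda>n. conv (W (Suc n)) e x) \<longlonglongrightarrow> p x" for x using ptw by simp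
    then show "conv p e = p" using lim_conv[OF e] LIMSEQ_unique by blast
  qed
qed

lemma sqnorm_idempotent:
  fixes p :: "'g \<Rightarrow> complex"
  assumes "hermitian_idempotent p"
  shows "p 0 = of_real (sqnorm p)" and "sqnorm p \<ge> 1" and "norm (p x) \<le> sqnorm p"
proof -
  have p: "continuous_on UNIV p" "hermitian p" "conv p p = p"
    using assms by (auto simp: hermitian_idempotent_def)
  show "p 0 = of_real (sqnorm p)" using conv_self_zero[OF K p(1,2)] p(3) by simp
  have pos: "sqnorm p > 0"
    using assms mean_mult_cnj(3)[OF K p(1)] by (auto simp: hermitian_idempotent_def)
  have le: "(norm (p x))\<^sup>2 \<le> sqnorm p * sqnorm p" for x
    using conv_norm_le[OF K p(1,1), of x] p(3) by simp
  then have "sqnorm p \<le> sqnorm p * sqnorm p" by (rule sqnorm_le[OF K p(1)])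
  then show "sqnorm p \<ge> 1" using pos by simp
  show "norm (p x) \<le> sqnorm p"
    by (rule power2_le_imp_le) (use le[of x] pos in \<open>auto simp: power2_eq_square\<close>)
qed

text \<open>
  The difference \<open>p - q\<close> is again an idempotent, and \<open>p 0\<close> is additive.
\<close>

lemma sqnorm_subidempotent:
  fixes p :: "'g \<Rightarrow> complex"
  assumes p: "hermitian_idempotent p" and q: "hermitian_idempotent q" and "conv p q = q" "q \<noteq> p"
  shows "sqnorm q + 1 \<le> sqnorm p"
proof -
  have cp: "continuous_on UNIV p" "hermitian p" "conv p p = p"
    and cq: "continuous_on UNIV q" "hermitian q" "conv q q = q"
    using p q by (auto simp: hermitian_idempotent_def)
  have c: "continuous_on UNIV (\<lambda>x. p x - q x)" by (intro continuous_intros cp cq)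
  have "conv q p = q" using conv_commute[OF K cp(1) cq(1)] assms(3) by simp
  then have "conv (\<lambda>x. p x - q x) (\<lambda>x. p x - q x) = (\<lambda>x. p x - q x)"
    using assms(3) cp(3) cq(3)
    by (simp add: conv_diff_left[OF K cp(1) cq(1) c] conv_diff_right[OF K cp(1) cq(1) cp(1)]
        conv_diff_right[OF K cp(1) cq(1) cq(1)])
  then have "hermitian_idempotent (\<lambda>x. p x - q x)"
    using c cp(2) cq(2) \<open>q \<noteq> p\<close> unfolding hermitian_idempotent_def hermitian_def by force
  note d = sqnorm_idempotent[OF this]
  have "complex_of_real (sqnorm (\<lambda>x. p x - q x)) = of_real (sqnorm p - sqnorm q)"
    using d(1) sqnorm_idempotent(1)[OF p] sqnorm_idempotent(1)[OF q] by simp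
  then have "sqnorm (\<lambda>x. p x - q x) = sqnorm p - sqnorm q" by (simp only: of_real_eq_iff)
  with d(2) show ?thesis by simp
qed

text \<open>
  Polarisation: a hermitian \<open>h\<close> in the ideal generated by \<open>p\<close> satisfies
  \<open>2 h = (h + p)\<^sup>2 - h\<^sup>2 - p\<close>, so if all squares are multiples of \<open>p\<close>, then
  \<open>h\<close> is one itself. The translates of \<open>p\<close> lie in the ideal and are complex combinations of
  hermitian elements of it.
\<close>

lemma character_of_minimal_idempotent:
  fixes p :: "'g \<Rightarrow> complex"
  assumes p: "hermitian_idempotent p"
    and minimal: "\<And>h. continuous_on UNIV h \<Longrightarrow> hermitian h \<Longrightarrow> conv p h = h \<Longrightarrow>
      \<exists>c. conv h h = (\<lambda>x. c * p x)"
  obtains \<phi> where "\<phi> \<in> dual_group" "\<And>g x. p (x + g) = \<phi> g * p x"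
proof -
  have cp: "continuous_on UNIV p" "hermitian p" "conv p p = p"
    using p by (auto simp: hermitian_idempotent_def)
  have p0: "p 0 = of_real (sqnorm p)" "sqnorm p \<ge> 1" using sqnorm_idempotent[OF p] by auto
  have one_dim: "\<exists>c. h = (\<lambda>x. c * p x)"
    if h: "continuous_on UNIV h" "hermitian h" "conv p h = h" for h
  proof -
    have s: "continuous_on UNIV (\<lambda>x. h x + p x)" by (intro continuous_intros h cp)
    have hp: "conv h p = h" using conv_commute[OF K h(1) cp(1)] h(3) by simp
    have "hermitian (\<lambda>x. h x + p x)" using h(2) cp(2) by (simp add: hermitian_def)
    moreover have "conv p (\<lambda>x. h x + p x) = (\<lambda>x. h x + p x)"
      by (simp add: conv_add_right[OF K h(1) cp(1,1)] h(3) cp(3))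
    ultimately obtain c where "conv (\<lambda>x. h x + p x) (\<lambda>x. h x + p x) = (\<lambda>x. c * p x)"
      using minimal[OF s] by blast
    moreover obtain d where "conv h h = (\<lambda>x. d * p x)" using minimal[OF h] by blast
    moreover have "conv (\<lambda>x. h x + p x) (\<lambda>x. h x + p x) = (\<lambda>x. conv h h x + 2 * h x + p x)"
      by (simp add: conv_add_left[OF K h(1) cp(1) s] conv_add_right[OF K h(1) cp(1) h(1)]
          conv_add_right[OF K h(1) cp(1,1)] h(3) hp cp(3) algebra_simps)
    ultimately have "d * p x + 2 * h x + p x = c * p x" for x by metis
    then have "h x = (c - d - 1) / 2 * p x" for x
      by (simp add: field_simps)
    then show ?thesis by blast
  qed
  define t where "t g x = p (x + g)" for g x
  have t: "continuous_on UNIV (t g)" for g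
    unfolding t_def[abs_def] by (rule continuous_UNIV_compose[OF cp(1)]) (intro continuous_intros)
  have pt: "conv p (t g) = t g" for g
    unfolding t_def[abs_def] by (simp add: conv_shift_right cp(3))
  have t_minus: "t g (- x) = cnj (t (- g) x)" for g x
    using hermitianD[OF cp(2), of "x - g"] by (simp add: t_def)
  have "\<exists>c. t g = (\<lambda>x. c * p x)" for g
  proof -
    have "continuous_on UNIV (\<lambda>x. t g x + t (- g) x)" by (intro continuous_intros t)
    moreover have "hermitian (\<lambda>x. t g x + t (- g) x)" by (simp add: hermitian_def t_minus)
    moreover have "conv p (\<lambda>x. t g x + t (- g) x) = (\<lambda>x. t g x + t (- g) x)"
      by (simp add: conv_add_right[OF K t t cp(1)] pt)
    ultimately obtain c where c: "(\<lambda>x. t g x + t (- g) x) = (\<lambda>x. c * p x)"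
      using one_dim by metis
    \<comment> \<open>The adjoint of the translate by \<open>g\<close> is the translate by \<open>- g\<close>, so their sum is hermitian,
      and so is \<open>\<i>\<close> times their difference.\<close>
    have s: "continuous_on UNIV (\<lambda>x. t g x - t (- g) x)" by (intro continuous_intros t)
    then have "continuous_on UNIV (\<lambda>x. \<i> * (t g x - t (- g) x))" by (rule continuous_on_mult_left)
    moreover have "hermitian (\<lambda>x. \<i> * (t g x - t (- g) x))"
      by (simp add: hermitian_def t_minus algebra_simps)
    moreover have "conv p (\<lambda>x. \<i> * (t g x - t (- g) x)) = (\<lambda>x. \<i> * (t g x - t (- g) x))"
      by (simp add: conv_scale_right[OF K s cp(1)] conv_diff_right[OF K t t cp(1)] pt)
    ultimately obtain d where d: "(\<lambda>x. \<i> * (t g x - t (- g) x)) = (\<lambda>x. d * p x)"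
      using one_dim by metis
    have "t g x = (c - \<i> * d) / 2 * p x" for x
    proof -
      have "2 * t g x = (t g x + t (- g) x) - \<i> * (\<i> * (t g x - t (- g) x))"
        by (simp add: algebra_simps flip: mult.assoc)
      also have "\<dots> = c * p x - \<i> * (d * p x)" using fun_cong[OF c, of x] fun_cong[OF d, of x] by simp
      finally show ?thesis by (simp add: algebra_simps)
    qed
    then show ?thesis by blast
  qed
  then have "\<exists>\<phi>. \<forall>g. t g = (\<lambda>x. \<phi> g * p x)" by metis
  then obtain \<phi> where "\<And>g. t g = (\<lambda>x. \<phi> g * p x)" by blast
  then have \<phi>: "p (x + g) = \<phi> g * p x" for g x by (metis t_def)
  have p0_nz: "p 0 \<noteq> 0" using p0 by simp
  have \<phi>_eq: "\<phi> g = p g / p 0" for g using \<phi>[of 0 g] p0_nz by simp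
  have hom: "\<phi> (g + h) = \<phi> g * \<phi> h" for g h
  proof -
    have "\<phi> (g + h) * p 0 = p (g + h)" using \<phi>[of 0 "g + h"] by simp
    also have "\<dots> = \<phi> h * p g" by (rule \<phi>)
    also have "p g = \<phi> g * p 0" using \<phi>[of 0 g] by simp
    finally have "\<phi> (g + h) * p 0 = (\<phi> g * \<phi> h) * p 0"
      by (simp only: ac_simps)
    then show ?thesis using p0_nz by simp
  qed
  have le: "norm (\<phi> g) \<le> 1" for g
    using sqnorm_idempotent(3)[OF p, of g] p0 by (simp add: \<phi>_eq norm_divide)
  have "norm (\<phi> g) = 1" for g
  proof -
    have "\<phi> g * \<phi> (- g) = 1" using hom[of g "- g"] \<phi>_eq[of 0] p0_nz by simp
    then have "norm (\<phi> g) * norm (\<phi> (- g)) = 1" by (metis norm_mult norm_one)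
    moreover have "norm (\<phi> g) * norm (\<phi> (- g)) \<le> norm (\<phi> g) * 1"
      by (intro mult_left_mono le) simp
    ultimately show ?thesis using le[of g] by simp
  qed
  moreover have "continuous_on UNIV \<phi>"
    unfolding \<phi>_eq[abs_def] by (intro continuous_intros cp(1)) (simp add: p0_nz)
  ultimately have "\<phi> \<in> dual_group" using hom by (auto simp: dual_group_def)
  then show thesis using that \<phi> by blast
qed

text \<open>
  If \<open>p\<close> is not minimal, then some square \<open>h * h\<close> of a hermitian element of its ideal is not a
  multiple of \<open>p\<close>. The idempotent \<open>q\<close> that power iteration yields from \<open>h\<close> is then
  different from \<open>p\<close>, because \<open>h * h * q\<close> is a multiple of \<open>q\<close> while
  \<open>h * h * p = h * h\<close>; so \<open>q\<close> has smaller norm.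
\<close>

lemma character_below_idempotent:
  fixes p :: "'g \<Rightarrow> complex"
  assumes "hermitian_idempotent p"
  shows "\<exists>q \<phi>. hermitian_idempotent q \<and> conv p q = q \<and> \<phi> \<in> dual_group \<and>
    (\<forall>g x. q (x + g) = \<phi> g * q x)"
proof -
  obtain n where "sqnorm p \<le> real n" using real_arch_simple by blast
  then show ?thesis
    using assms
  proof (induction n arbitrary: p)
    case 0
    then show ?case using sqnorm_idempotent(2)[of p] by simp
  next
    case (Suc n)
    note p = Suc.prems(2)
    have cp: "continuous_on UNIV p" "hermitian p" "conv p p = p"
      using p by (auto simp: hermitian_idempotent_def)
    show ?case
    proof (cases "\<forall>h. continuous_on UNIV h \<longrightarrow> hermitian h \<longrightarrow> conv p h = h \<longrightarrow>
        (\<exists>c. conv h h = (\<lambda>x. c * p x))")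
      case True
      then show ?thesis
        using character_of_minimal_idempotent[OF p] p cp(3) by metis
    next
      case False
      then obtain h where h: "continuous_on UNIV h" "hermitian h" "conv p h = h"
        and not_multiple: "\<nexists>c. conv h h = (\<lambda>x. c * p x)" by blast
      have "\<exists>x. h x \<noteq> 0"
      proof (rule ccontr)
        assume "\<nexists>x. h x \<noteq> 0"
        then have "conv h h = (\<lambda>x. 0 * p x)" by (simp add: conv_def mean_const[OF K] fun_eq_iff)
        with not_multiple show False by blast
      qed
      then obtain x0 where "h x0 \<noteq> 0" by blast
      from spectral_idempotent[OF h(1,2) this]
      obtain q and l :: real where q: "continuous_on UNIV q" "hermitian q" "conv q q = q" "q 0 \<noteq> 0"
        and l: "conv (conv h h) q = (\<lambda>x. of_real l * q x)"
        and unit: "\<And>e. continuous_on UNIV e \<Longrightarrow> conv h e = h \<Longrightarrow> conv q e = q"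
        by metis
      have hp: "conv h p = h" using conv_commute[OF K h(1) cp(1)] h(3) by simp
      have pq: "conv p q = q" using unit[OF cp(1) hp] conv_commute[OF K cp(1) q(1)] by simp
      have qi: "hermitian_idempotent q" using q by (auto simp: hermitian_idempotent_def)
      have "q \<noteq> p"
      proof
        assume "q = p"
        then have "conv h h = (\<lambda>x. of_real l * p x)"
          using l conv_assoc[OF K h(1,1) cp(1)] hp by simp
        with not_multiple show False by blast
      qed
      from sqnorm_subidempotent[OF p qi pq this] Suc.prems(1) have "sqnorm q \<le> real n" by simp
      from Suc.IH[OF this qi] obtain r \<phi> where r: "hermitian_idempotent r" "conv q r = r"
        "\<phi> \<in> dual_group" "\<forall>g x. r (x + g) = \<phi> g * r x" by blast
      have cr: "continuous_on UNIV r" using r(1) by (simp add: hermitian_idempotent_def)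
      have "conv p r = conv (conv p q) r"
        using r(2) conv_assoc[OF K cp(1) q(1) cr] by simp
      then have "conv p r = r" using pq r(2) by simp
      with r show ?thesis by blast
    qed
  qed
qed

text \<open>
  \<open>v = u * u\<^sup>*\<close> lies in the ideal generated by the difference \<open>u\<close> of \<open>h\<close> and its
  translate by \<open>g\<close>, and \<open>u\<close> annihilates every \<open>q\<close> that is invariant under translation by \<open>g\<close>.
\<close>

lemma characters_separate_point:
  fixes h :: "'g \<Rightarrow> complex"
  assumes h: "continuous_on UNIV h" and "h 0 \<noteq> h g"
  obtains \<phi> where "\<phi> \<in> dual_group" "\<phi> g \<noteq> 1"
proof -
  define u where "u x = h x - h (x + g)" for x
  define w where "w x = cnj (u (- x))" for x
  define v where "v = conv u w"
  have hg: "continuous_on UNIV (\<lambda>x. h (x + g))"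
    by (rule continuous_UNIV_compose[OF h]) (intro continuous_intros)
  have u: "continuous_on UNIV u" unfolding u_def[abs_def] by (intro continuous_intros h hg)
  have w: "continuous_on UNIV w"
    unfolding w_def[abs_def] by (intro continuous_on_cnj continuous_UNIV_compose[OF u] continuous_intros)
  have v: "continuous_on UNIV v" unfolding v_def by (rule continuous_conv[OF K u w])
  have "hermitian v"
    unfolding hermitian_def
  proof
    fix x
    have "cnj (v x) = mean (\<lambda>y. cnj (u y) * u (y - x))"
      using mean_cnj[OF K continuous_conv_integrand[OF K u w], of x] by (simp add: v_def conv_def w_def)
    also have "\<dots> = mean (\<lambda>y. cnj (u (y + x)) * u (y + x - x))"
      by (rule mean_shift[OF K, symmetric])
        (intro continuous_on_mult continuous_on_cnj u continuous_UNIV_compose[OF u] continuous_intros)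
    finally show "v (- x) = cnj (v x)" by (simp add: v_def conv_def w_def ac_simps)
  qed
  moreover have "v 0 = of_real (sqnorm u)"
    by (simp add: v_def conv_def w_def mean_mult_cnj(1)[OF K u])
  moreover have "sqnorm u > 0"
    using mean_mult_cnj(3)[OF K u, of 0] assms(2) by (simp add: u_def)
  ultimately obtain p and l :: real where p: "continuous_on UNIV p" "hermitian p" "conv p p = p" "p 0 \<noteq> 0"
    and l: "l > 0" "conv (conv v v) p = (\<lambda>x. of_real l * p x)"
    using spectral_idempotent[OF v, of 0] by (metis less_irrefl of_real_eq_0_iff)
  have "hermitian_idempotent p" using p by (auto simp: hermitian_idempotent_def)
  then obtain q \<phi> where q: "hermitian_idempotent q" "conv p q = q"
    and \<phi>: "\<phi> \<in> dual_group" "\<And>g x. q (x + g) = \<phi> g * q x"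
    using character_below_idempotent by blast
  have cq: "continuous_on UNIV q" using q(1) by (simp add: hermitian_idempotent_def)
  have conv_0: "conv f (\<lambda>_. 0) = (\<lambda>_. 0)" for f :: "'g \<Rightarrow> complex"
    by (simp add: conv_def mean_const[OF K] fun_eq_iff)
  have "\<phi> g \<noteq> 1"
  proof
    assume "\<phi> g = 1"
    then have qg: "(\<lambda>x. q (x + g)) = q" using \<phi>(2)[of _ g] by simp
    have "conv (\<lambda>x. h (x + g)) q = (\<lambda>x. conv q h (x + g))"
      using conv_commute[OF K hg cq] conv_shift_right[of q h g] by simp
    also have "\<dots> = conv h q"
      using conv_commute[OF K h cq] conv_shift_right[of h q g] qg by simp
    finally have "conv u q = (\<lambda>_. 0)"
      unfolding u_def[abs_def] by (simp add: conv_diff_left[OF K h hg cq])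
    then have "conv v q = (\<lambda>_. 0)"
      unfolding v_def by (simp add: conv_commute[OF K u w] conv_assoc[OF K w u cq] conv_0)
    then have "conv (conv v v) q = (\<lambda>_. 0)" by (simp add: conv_assoc[OF K v v cq] conv_0)
    moreover have "conv (conv v v) q = conv (conv (conv v v) p) q"
      by (simp add: conv_assoc[OF K continuous_conv[OF K v v] p(1) cq] q(2))
    then have "conv (conv v v) q = (\<lambda>x. of_real l * q x)"
      by (simp add: l(2) conv_scale_left[OF K p(1) cq] q(2))
    ultimately have "of_real l * q x = 0" for x by metis
    then show False using l(1) q(1) by (auto simp: hermitian_idempotent_def)
  qed
  with \<phi>(1) show thesis using that by blast
qed

end

theorem dual_group_separates_points:
  fixes g :: "'g::{topological_ab_group_add, t2_space}"
  assumes K: "compact (UNIV :: 'g set)" and "g \<noteq> 0"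
  obtains \<phi> where "\<phi> \<in> dual_group" "\<phi> g \<noteq> 1"
proof -
  have "Hausdorff_space (euclidean :: 'g topology)"
    unfolding Hausdorff_space_def disjnt_def using hausdorff by auto
  then have "normal_space (euclidean :: 'g topology)"
    using K by (intro compact_Hausdorff_or_regular_imp_normal_space) (auto simp: compact_space_def)
  then obtain f :: "'g \<Rightarrow> real" where "continuous_map euclidean euclideanreal f" "f ` {0} \<subseteq> {0}" "f ` {g} \<subseteq> {1}"
    using Urysohn_lemma_alt[of euclidean "{0}" "{g}" 0 1] \<open>g \<noteq> 0\<close> by (auto simp: disjnt_def)
  then have "continuous_on UNIV (\<lambda>x. complex_of_real (f x))" "complex_of_real (f 0) \<noteq> of_real (f g)"
    by (auto intro!: continuous_intros)
  from characters_separate_point[OF K this] that show thesis by metis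
qed


section \<open>One-dimensional representations\<close>

lemma free_scale_single: "free_scale c (Poly_Mapping.single b d) = Poly_Mapping.single b (c * d)"
  by (rule poly_mapping_eqI) (simp add: lookup_single when_def)

definition line_topology :: "'b \<Rightarrow> ('b \<Rightarrow>\<^sub>0 complex) topology" where
  "line_topology b =
     pullback_topology (range (Poly_Mapping.single b)) (\<lambda>f. Poly_Mapping.lookup f b) euclidean"

lemma topspace_line: "topspace (line_topology b) = range (Poly_Mapping.single b)"
  by (simp add: line_topology_def topspace_pullback_topology)

lemma subspace_line: "free_vs.subspace (range (Poly_Mapping.single b))"
proof -
  have "0 \<in> range (Poly_Mapping.single b)" by (rule range_eqI[of _ _ 0]) simp
  then show ?thesis
    unfolding free_vs.subspace_def by (auto simp: free_scale_single single_add[symmetric])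
qed

lemma continuous_map_coordinate:
  "continuous_map (line_topology b) euclidean (\<lambda>f. Poly_Mapping.lookup f b)"
  unfolding line_topology_def
  using continuous_map_pullback[of euclidean euclidean id] by (simp add: o_def)

text \<open>
  All topological properties of the line are checked in its coordinate.
\<close>

lemma continuous_map_into_line:
  assumes "continuous_map X euclidean (\<lambda>x. Poly_Mapping.lookup (h x) b)"
    and "\<And>x. x \<in> topspace X \<Longrightarrow> h x \<in> range (Poly_Mapping.single b)"
  shows "continuous_map X (line_topology b) h"
  unfolding line_topology_def
  by (rule continuous_map_pullback') (use assms in \<open>auto simp: o_def\<close>)

lemma continuous_map_binary:
  assumes "continuous_map X euclidean f" "continuous_map X euclidean g"
    and "continuous_on UNIV (\<lambda>(s, t). F s t)"
  shows "continuous_map X euclidean (\<lambda>x. F (f x) (g x))"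
proof -
  have "continuous_map X euclidean (\<lambda>x. (f x, g x))"
    using continuous_map_pairedI[OF assms(1,2)] by simp
  from continuous_map_compose[OF this, of euclidean "\<lambda>(s, t). F s t"] assms(3)
  show ?thesis by (simp add: o_def)
qed

lemma locally_convex_line:
  fixes b :: 'b
  shows "locally_convex_space free_scale (line_topology b)"
  unfolding locally_convex_space_def topspace_line
proof (intro conjI allI impI vector_space_free_scale subspace_line)
  let ?T = "line_topology b"
  have c1: "continuous_map (prod_topology X ?T) euclidean (\<lambda>x. Poly_Mapping.lookup (snd x) b)" for X :: "'z topology"
    using continuous_map_compose[OF continuous_map_snd continuous_map_coordinate] by (simp add: o_def)
  have c2: "continuous_map (prod_topology ?T ?T) euclidean (\<lambda>x. Poly_Mapping.lookup (fst x) b)"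
    using continuous_map_compose[OF continuous_map_fst continuous_map_coordinate] by (simp add: o_def)
  show "continuous_map (prod_topology ?T ?T) ?T (\<lambda>(x, y). x + y)"
  proof (rule continuous_map_into_line)
    show "continuous_map (prod_topology ?T ?T) euclidean (\<lambda>x. Poly_Mapping.lookup (case x of (x, y) \<Rightarrow> x + y) b)"
      using continuous_map_binary[OF c2 c1, of "(+)"]
      by (simp add: case_prod_unfold lookup_add continuous_intros)
  qed (auto simp: topspace_line single_add[symmetric])
  show "continuous_map (prod_topology euclidean ?T) ?T (\<lambda>(c, x). free_scale c x)"
  proof (rule continuous_map_into_line)
    show "continuous_map (prod_topology euclidean ?T) euclidean
        (\<lambda>x. Poly_Mapping.lookup (case x of (c, x) \<Rightarrow> free_scale c x) b)"
      using continuous_map_binary[OF continuous_map_fst c1, of "(*)"]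
      by (simp add: case_prod_unfold continuous_intros)
  qed (auto simp: topspace_line free_scale_single)
next
  fix U assume "openin (line_topology b) U \<and> 0 \<in> U"
  then obtain O' where O': "open O'" "U = (\<lambda>f. Poly_Mapping.lookup f b) -` O' \<inter> range (Poly_Mapping.single b)" "0 \<in> U"
    by (auto simp: line_topology_def openin_pullback_topology)
  then have "0 \<in> O'" by auto
  with O'(1) obtain e where e: "e > 0" "ball 0 e \<subseteq> O'" using open_contains_ball by blast
  define W :: "('b \<Rightarrow>\<^sub>0 complex) set" where "W = (\<lambda>f. Poly_Mapping.lookup f b) -` ball 0 e \<inter> range (Poly_Mapping.single b)"
  have "openin (line_topology b) W"
    unfolding W_def line_topology_def openin_pullback_topology by (metis open_ball open_openin)
  moreover have "0 \<in> W" using e O'(2,3) by (auto simp: W_def)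
  moreover have "W \<subseteq> U" using e O'(2) by (auto simp: W_def)
  moreover have "complex_convex free_scale W"
    unfolding complex_convex_def
  proof (intro ballI allI impI)
    fix x y and t :: real assume xy: "x \<in> W" "y \<in> W" and t: "0 \<le> t \<and> t \<le> 1"
    have "(1 - t) *\<^sub>R Poly_Mapping.lookup x b + t *\<^sub>R Poly_Mapping.lookup y b \<in> ball 0 e"
      using xy t by (intro convexD[OF convex_ball]) (auto simp: W_def)
    moreover have "free_scale (of_real (1 - t)) x + free_scale (of_real t) y \<in> range (Poly_Mapping.single b)"
      using xy free_vs.subspace_add[OF subspace_line[of b]] free_vs.subspace_scale[OF subspace_line[of b]]
      by (simp add: W_def)
    ultimately show "free_scale (of_real (1 - t)) x + free_scale (of_real t) y \<in> W"
      by (simp add: W_def lookup_add scaleR_conv_of_real)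
  qed
  ultimately show "\<exists>W. openin (line_topology b) W \<and> 0 \<in> W \<and> W \<subseteq> U \<and> complex_convex free_scale W"
    by blast
qed

lemma Hausdorff_line: "Hausdorff_space (line_topology b)"
proof (rule Hausdorff_space_injective_preimage[OF _ continuous_map_coordinate])
  show "inj_on (\<lambda>f. Poly_Mapping.lookup f b) (topspace (line_topology b))"
    by (auto simp: inj_on_def topspace_line)
qed simp

lemma dual_groupD:
  assumes "\<phi> \<in> dual_group"
  shows "continuous_on UNIV \<phi>" and "\<phi> (g + h) = \<phi> g * \<phi> h" and "\<phi> 0 = 1"
proof -
  show "continuous_on UNIV \<phi>" and add: "\<phi> (g + h) = \<phi> g * \<phi> h" for g h
    using assms by (auto simp: dual_group_def)
  have "\<phi> 0 \<in> sphere 0 1" using assms unfolding dual_group_def by blast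
  then have "\<phi> 0 \<noteq> 0" by auto
  with add[of 0 0] show "\<phi> 0 = 1" by simp
qed

lemma continuous_representation_character:
  assumes "\<phi> \<in> dual_group"
  shows "continuous_representation free_scale (line_topology b) (\<lambda>g. free_scale (\<phi> g))"
  unfolding continuous_representation_def
proof (intro conjI allI ballI locally_convex_line Hausdorff_line)
  let ?T = "line_topology b"
  have "continuous_map (prod_topology euclidean ?T) euclidean (\<lambda>x. \<phi> (fst x))"
    using continuous_map_compose[OF continuous_map_fst, of euclidean euclidean \<phi>] dual_groupD(1)[OF assms]
    by (simp add: o_def)
  moreover have "continuous_map (prod_topology euclidean ?T) euclidean (\<lambda>x. Poly_Mapping.lookup (snd x) b)"
    using continuous_map_compose[OF continuous_map_snd continuous_map_coordinate] by (simp add: o_def)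
  ultimately have c: "continuous_map (prod_topology euclidean ?T) euclidean (\<lambda>x. \<phi> (fst x) * Poly_Mapping.lookup (snd x) b)"
    by (rule continuous_map_binary) (simp add: case_prod_unfold continuous_intros)
  show "continuous_map (prod_topology euclidean ?T) ?T (\<lambda>(g, v). free_scale (\<phi> g) v)"
    by (rule continuous_map_into_line)
      (use c in \<open>auto simp: case_prod_unfold topspace_line free_scale_single\<close>)
qed (simp_all add: dual_groupD[OF assms] free_vs.scale_right_distrib free_vs.scale_left_commute)

lemma dual_group_inverse:
  fixes \<phi> :: "'g::topological_ab_group_add \<Rightarrow> complex"
  assumes "\<phi> \<in> dual_group"
  shows "(\<lambda>g. \<phi> (- g)) \<in> dual_group"
proof -
  have "continuous_on UNIV (\<lambda>g. \<phi> (- g))"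
    by (rule continuous_on_compose2[OF dual_groupD(1)[OF assms]]) (auto intro!: continuous_intros)
  moreover have "\<phi> (- (g + h)) = \<phi> (- g) * \<phi> (- h)" for g h
    by (simp only: minus_add_distrib dual_groupD(2)[OF assms])
  ultimately show ?thesis
    using assms by (auto simp: dual_group_def)
qed

text \<open>
  Both sides of the equivariance condition equal \<open>\<phi> (- g) \<sqdot> (a \<otimes> v)\<close>: on the left the scalar
  comes from \<open>a\<close>, on the right from \<open>v\<close>. Hence the inverse character in the isotypic component.
\<close>

lemma equivariant_elementary_tensor:
  fixes \<phi> :: "'g::topological_group_add \<Rightarrow> complex" and V :: "('c \<Rightarrow>\<^sub>0 complex) set"
    and sA :: "complex \<Rightarrow> 'a::ab_group_add \<Rightarrow> 'a"
  assumes lin: "\<And>g. Vector_Spaces.linear sA sA (\<alpha> g)"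
    and a: "a \<in> isotypic_component sA \<alpha> (\<lambda>g. \<phi> (- g))"
    and V: "free_vs.subspace V" and v: "v \<in> V"
  shows "tensor_rel sA free_scale V `` {free_gen a v} \<in>
    equivariant_tensors sA \<alpha> free_scale V (\<lambda>g. free_scale (\<phi> g))"
proof -
  interpret A: vector_space sA using lin[of 0] by (simp add: Vector_Spaces.linear_def)
  let ?R = "tensor_rel sA free_scale V"
  have gen: "free_gen x w \<in> free_tensors V" if "w \<in> V" for x :: 'a and w :: "'c \<Rightarrow>\<^sub>0 complex"
    using that by (simp add: free_tensors_def)
  have free_map_gen: "free_map F H (free_gen x w) = free_gen (F x) (H w)"
    for F :: "'a \<Rightarrow> 'a" and H :: "('c \<Rightarrow>\<^sub>0 complex) \<Rightarrow> ('c \<Rightarrow>\<^sub>0 complex)" and x w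
    by (simp add: free_map_def linear_extension_single[OF vector_space_free_scale])
  have "tensor_map sA free_scale V (\<alpha> g) id (?R `` {free_gen a v}) =
      tensor_map sA free_scale V id (free_scale (\<phi> (- g))) (?R `` {free_gen a v})" for g
  proof -
    define c where "c = \<phi> (- g)"
    have cv: "free_scale c v \<in> V" by (rule free_vs.subspace_scale[OF V v])
    have "tensor_map sA free_scale V (\<alpha> g) id (?R `` {free_gen a v}) = ?R `` {free_gen (sA c a) v}"
      using a by (subst tensor_map_class[OF lin]) (auto simp: gen v free_map_gen isotypic_component_def c_def)
    also have "\<dots> = ?R `` {free_gen a (free_scale c v)}"
    proof (rule equiv_class_eq[OF equiv_tensor_rel])
      have "free_gen (sA c a) v - free_scale c (free_gen a v) \<in> tensor_relators sA free_scale V"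
        "free_gen a (free_scale c v) - free_scale c (free_gen a v) \<in> tensor_relators sA free_scale V"
        using v unfolding tensor_relators_def by blast+
      then have "(free_gen (sA c a) v - free_scale c (free_gen a v)) -
          (free_gen a (free_scale c v) - free_scale c (free_gen a v)) \<in>
          free_vs.span (tensor_relators sA free_scale V)"
        by (intro free_vs.span_diff free_vs.span_base)
      then show "(free_gen (sA c a) v, free_gen a (free_scale c v)) \<in> ?R"
        using gen[OF v] gen[OF cv] by (simp add: tensor_rel_def)
    qed
    also have "\<dots> = tensor_map sA free_scale V id (free_scale c) (?R `` {free_gen a v})"
      by (subst tensor_map_class[OF A.linear_id])
        (auto simp: gen v free_map_gen free_vs.subspace_scale[OF V] free_vs.scale_right_distrib
          free_vs.scale_left_commute)
    finally show ?thesis by (simp only: c_def)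
  qed
  moreover have "?R `` {free_gen a v} \<in> tensor_space sA free_scale V"
    unfolding tensor_space_def by (rule quotientI[OF gen[OF v]])
  ultimately show ?thesis by (simp add: equivariant_tensors_def)
qed

lemma tensor_eval_mem:
  assumes \<xi>: "Vector_Spaces.linear sA (*) \<xi>" and V: "free_vs.subspace V"
    and s: "s \<in> tensor_space sA free_scale V"
  shows "tensor_eval free_scale \<xi> s \<in> V"
proof -
  from s obtain f where f: "f \<in> free_tensors V" "s = tensor_rel sA free_scale V `` {f}"
    unfolding tensor_space_def by (rule quotientE)
  have "free_eval free_scale \<xi> f \<in> V"
    unfolding free_eval_def linear_extension_def
    by (rule free_vs.subspace_sum[OF V])
      (use f in \<open>auto simp: free_tensors_def intro!: free_vs.subspace_scale[OF V]\<close>)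
  then show ?thesis
    using tensor_eval_class[OF vector_space_free_scale \<xi> f(1)] f(2) by simp
qed

lemma character_evaluation_surjective:
  fixes \<phi> :: "'g::topological_group_add \<Rightarrow> complex"
  assumes lin: "\<And>g. Vector_Spaces.linear sA sA (\<alpha> g)" and \<xi>: "Vector_Spaces.linear sA (*) \<xi>"
    and surj: "\<xi> ` isotypic_component sA \<alpha> (\<lambda>g. \<phi> (- g)) = UNIV"
  shows "tensor_eval free_scale \<xi> `
      equivariant_tensors sA \<alpha> free_scale (range (Poly_Mapping.single b)) (\<lambda>g. free_scale (\<phi> g)) =
    range (Poly_Mapping.single b)" (is "_ ` ?E = ?V")
proof (intro equalityI subsetI)
  fix w assume "w \<in> tensor_eval free_scale \<xi> ` ?E"
  then show "w \<in> ?V" using tensor_eval_mem[OF \<xi> subspace_line] by (auto simp: equivariant_tensors_def)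
next
  fix w assume "w \<in> ?V"
  then obtain c where w: "w = Poly_Mapping.single b c" by blast
  obtain a where a: "a \<in> isotypic_component sA \<alpha> (\<lambda>g. \<phi> (- g))" "\<xi> a = c"
    using surj by (metis UNIV_I imageE)
  let ?v = "Poly_Mapping.single b (1::complex)"
  have "free_gen a ?v \<in> free_tensors ?V" by (auto simp: free_tensors_def)
  then have "tensor_eval free_scale \<xi> (tensor_rel sA free_scale ?V `` {free_gen a ?v}) =
      free_eval free_scale \<xi> (free_gen a ?v)"
    by (rule tensor_eval_class[OF vector_space_free_scale \<xi>])
  also have "\<dots> = w"
    by (simp add: free_eval_def linear_extension_single[OF vector_space_free_scale] free_scale_single a w)
  finally show "w \<in> tensor_eval free_scale \<xi> ` ?E"
    using equivariant_elementary_tensor[OF lin a(1) subspace_line, of ?v b] by force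
qed


section \<open>Freeness\<close>

theorem proposition6p5p9:
  fixes sA :: "complex \<Rightarrow> 'a::{comm_ring, monoid_mult} \<Rightarrow> 'a"
    and TA :: "'a topology"
    and \<alpha> :: "'g::{topological_ab_group_add, t2_space} \<Rightarrow> 'a \<Rightarrow> 'a"
  assumes "compact (UNIV :: 'g set)"
    and "dynamical_system sA TA \<alpha>"
    and "\<forall>\<phi>\<in>dual_group. \<forall>\<xi>\<in>characters sA. \<xi> ` isotypic_component sA \<alpha> \<phi> = UNIV"
  shows "free_system sA TA \<alpha>"
proof -
  have lin: "Vector_Spaces.linear sA sA (\<alpha> g)" for g
    using assms(2) by (simp add: dynamical_system_def algebra_automorphism_def)
  define b :: "'g \<times> ('a \<Rightarrow> complex)" where "b = (0, \<lambda>_. 0)"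
  define \<pi> :: "('g \<Rightarrow> complex) \<Rightarrow> 'g \<Rightarrow> ('a, 'g) rep_universe \<Rightarrow> ('a, 'g) rep_universe"
    where "\<pi> \<phi> g = free_scale (\<phi> g)" for \<phi> g
  let ?T = "line_topology b"
  have "continuous_representation free_scale ?T (\<pi> \<phi>)" if "\<phi> \<in> dual_group" for \<phi>
    using continuous_representation_character[OF that] by (simp add: \<pi>_def[abs_def])
  moreover have "\<exists>\<phi>\<in>dual_group. \<exists>v\<in>topspace ?T. \<pi> \<phi> g v \<noteq> v" if "g \<noteq> 0" for g
  proof -
    obtain \<phi> where \<phi>: "\<phi> \<in> dual_group" "\<phi> g \<noteq> 1"
      using dual_group_separates_points[OF assms(1) \<open>g \<noteq> 0\<close>] by blast
    have "\<pi> \<phi> g (Poly_Mapping.single b 1) \<noteq> Poly_Mapping.single b 1"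
      using \<phi>(2) by (simp add: \<pi>_def free_scale_single) (metis lookup_single_eq)
    with \<phi>(1) show ?thesis by (auto simp: topspace_line)
  qed
  moreover have "tensor_eval free_scale \<xi> ` equivariant_tensors sA \<alpha> free_scale (topspace ?T) (\<pi> \<phi>) =
      topspace ?T" if "\<phi> \<in> dual_group" "\<xi> \<in> characters sA" for \<phi> \<xi>
    unfolding topspace_line \<pi>_def[abs_def]
  proof (rule character_evaluation_surjective[OF lin])
    show "Vector_Spaces.linear sA (*) \<xi>" using that(2) by (simp add: characters_def)
    show "\<xi> ` isotypic_component sA \<alpha> (\<lambda>g. \<phi> (- g)) = UNIV"
      using assms(3) dual_group_inverse[OF that(1)] that(2) by blast
  qed
  ultimately show ?thesis
    unfolding free_system_def using assms(2)
    by (intro conjI exI[of _ "(\<lambda>\<phi>. (?T, \<pi> \<phi>)) ` dual_group"]) auto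
qed

end
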